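(* Let $\mathbb{F}_q$ be a finite field, let $G\le \operatorname{PGL}_2(\mathbb{F}_q)$ be a cyclic subgroup of prime order $s$, and let $Q_G\in\mathbb{F}_q(x)$ be a quotient map for $G$. For all integers $n>d(G)$, $$|C(Q_G,n)|-(s-1)\,|D(Q_G,n)|=\begin{cases}0, & \text{if } s\nmid n,\\ |C(Q_G,\tfrac{n}{s})|, & \text{if } s\mid n.\end{cases}$$
   Context: $\mathcal{I}_q$ is the set of monic irreducible polynomials in $\mathbb{F}_q[x]$ and $\mathcal{I}_q^n$ the subset of those of degree $n$. For $A=\begin{pmatrix}a&b\\c&d\end{pmatrix}\in\operatorname{GL}_2(\mathbb{F}_q)$, $[A]$ denotes its class in $\operatorname{PGL}_2(\mathbb{F}_q)$, $[A]\circ x=\frac{ax+b}{cx+d}$, and $[A]\circ v=\frac{av+b}{cv+d}$ for $v\in\overline{\mathbb{F}}_q\cup\{\infty\}$ is the usual action. Quotient maps: for a subgroup $G\le\operatorname{PGL}_2(\mathbb{F}_q)$ let $\mathbb{F}_q(x)^G=\{Q\in\mathbb{F}_q(x)\mid Q([A]\circ x)=Q(x)\text{ for all }[A]\in G\}$. A quotient map for $G$ is a rational function $Q_G=g/h$ with $g,h\in\mathbb{F}_q[x]$ coprime, $g$ monic, $\deg(g)=|G|$, $0\le\deg(h)<\deg(g)$, and $\mathbb{F}_q(x)^G=\mathbb{F}_q(Q_G)$. Rational transformation: for $F\in\mathbb{F}_q[x]$ and $Q=g/h$, $F^{Q}(x):=h(x)^{\deg(F)}F\!\left(\frac{g(x)}{h(x)}\right)$.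 For $n\ge 1$: $C(Q_G,n):=\{f\in\mathcal{I}_q^n\mid f^{Q_G}\in\mathcal{I}_q^{|G|n}\}$ and $D(Q_G,n):=\mathcal{I}_q^n\setminus C(Q_G,n)$. Action on polynomials: $[A]\ast f(x)=\lambda_{A,f}(cx+d)^{\deg(f)}f\!\left(\frac{ax+b}{cx+d}\right)$, where $\lambda_{A,f}\in\mathbb{F}_q^{\ast}$ makes the result monic. Let $G\circ\infty$ be the $G$-orbit of $\infty$ and let $\mathcal{I}_q^G$ be the set of $r\in\mathcal{I}_q$ with no root in $G\circ\infty$; $G$ acts (on the right) on $\mathcal{I}_q^G$ via $\ast$. Write $G\ast r=\{[A]\ast r\mid [A]\in G\}$ and $\prod G\ast r:=\prod_{t\in G\ast r}t$. It is known that for every $F\in\mathcal{I}_q$ there are $r\in\mathcal{I}_q^G$ and an integer $k\ge 1$ with $F^{Q_G}=\left(\prod G\ast r\right)^k$. Definition of $d(G)$: $d(G)$ is the largest degree of a polynomial $F\in\mathcal{I}_q$ for which $F^{Q_G}=\left(\prod G\ast r\right)^k$ with $k>1$, and $d(G):=0$ if no such $F$ exists. One has $d(G)\in\{0,1,2\}$, and $d(G)$ does not depend on the choice of the quotient map $Q_G$. *)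

theory Defs
  imports
    "HOL-Algebra.Elementary_Groups"
    "HOL-Analysis.Determinants"
    "HOL-Computational_Algebra.Polynomial_Factorial"
begin

section \<open>The projective general linear group\<close>

definition GL2 :: "('a::field ^ 2 ^ 2) monoid" where
  "GL2 = \<lparr>carrier = {A. invertible A}, monoid.mult = (**), one = mat 1\<rparr>"

definition scalars2 :: "('a::field ^ 2 ^ 2) set" where
  "scalars2 = {mat c | c. c \<noteq> 0}"

text \<open>
  An element of \<open>PGL2\<close> is a set of matrices, namely the class \<open>[A]\<close> of all nonzero scalar multiples
  of an invertible matrix \<open>A\<close>.  For \<open>G \<subseteq> carrier PGL2\<close>, ``for all \<open>[A] \<in> G\<close>'' thus becomes
  ``for all \<open>A \<in> \<Union>G\<close>'': the actions below give the same result for all matrices in a class.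
\<close>

definition PGL2 :: "('a::field ^ 2 ^ 2) set monoid" where
  "PGL2 = GL2 Mod scalars2"

lemma group_GL2: "group (GL2 :: ('a::field ^ 2 ^ 2) monoid)"
proof (rule groupI)
  fix A :: "'a ^ 2 ^ 2"
  assume "A \<in> carrier GL2"
  then obtain B where "A ** B = mat 1" "B ** A = mat 1"
    by (auto simp: GL2_def invertible_def)
  then show "\<exists>B\<in>carrier GL2. B \<otimes>\<^bsub>GL2\<^esub> A = \<one>\<^bsub>GL2\<^esub>"
    by (auto simp: GL2_def invertible_def)
next
  fix A B :: "'a ^ 2 ^ 2"
  assume "A \<in> carrier GL2" "B \<in> carrier GL2"
  then show "A \<otimes>\<^bsub>GL2\<^esub> B \<in> carrier GL2"
    by (simp add: GL2_def invertible_mult)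
qed (auto simp: GL2_def matrix_mul_assoc invertible_def)

lemma mat_mul_left: "mat c ** (A :: 'a::field ^ 'n ^ 'n) = (\<chi> i j. c * A $ i $ j)"
  by (simp add: matrix_matrix_mult_def mat_def vec_eq_iff if_distrib[of "\<lambda>x. x * _"] cong: if_cong)

lemma mat_mul_right: "(A :: 'a::field ^ 'n ^ 'n) ** mat c = (\<chi> i j. c * A $ i $ j)"
  by (simp add: matrix_matrix_mult_def mat_def vec_eq_iff if_distrib[of "\<lambda>x. _ * x"] mult.commute
      cong: if_cong)

lemma mat_mul_mat: "mat c ** mat d = (mat (c * d) :: 'a::field ^ 'n ^ 'n)"
  unfolding mat_mul_left by (simp add: mat_def vec_eq_iff)

lemma normal_scalars2: "(scalars2 :: ('a::field ^ 2 ^ 2) set) \<lhd> GL2"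
proof -
  interpret group "GL2 :: ('a ^ 2 ^ 2) monoid" by (rule group_GL2)
  have inv: "invertible (mat c :: 'a ^ 2 ^ 2)" if "c \<noteq> 0" for c
    using that by (auto simp: invertible_def mat_mul_mat intro!: exI[of _ "mat (1 / c)"])
  have "subgroup (scalars2 :: ('a ^ 2 ^ 2) set) GL2"
  proof (rule subgroupI)
    show "(scalars2 :: ('a ^ 2 ^ 2) set) \<subseteq> carrier GL2"
      using inv by (auto simp: scalars2_def GL2_def)
    show "(scalars2 :: ('a ^ 2 ^ 2) set) \<noteq> {}"
      by (auto simp: scalars2_def intro: exI[of _ 1])
  next
    fix A :: "'a ^ 2 ^ 2"
    assume "A \<in> scalars2"
    then obtain c where c: "A = mat c" "c \<noteq> 0" by (auto simp: scalars2_def)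
    have "inv\<^bsub>GL2\<^esub> A = mat (1 / c)"
      by (rule inv_equality) (use c inv[of "1 / c"] inv[of c] in \<open>auto simp: GL2_def mat_mul_mat\<close>)
    with c show "inv\<^bsub>GL2\<^esub> A \<in> scalars2" by (auto simp: scalars2_def intro!: exI[of _ "1 / c"])
  next
    fix A B :: "'a ^ 2 ^ 2"
    assume "A \<in> scalars2" "B \<in> scalars2"
    then obtain c d where "A = mat c" "c \<noteq> 0" "B = mat d" "d \<noteq> 0" by (auto simp: scalars2_def)
    then show "A \<otimes>\<^bsub>GL2\<^esub> B \<in> scalars2"
      by (auto simp: scalars2_def GL2_def mat_mul_mat intro!: exI[of _ "c * d"])
  qed
  then show ?thesis
  proof (rule normalI, intro ballI)
    fix A :: "'a ^ 2 ^ 2"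
    show "scalars2 #>\<^bsub>GL2\<^esub> A = A <#\<^bsub>GL2\<^esub> scalars2"
      by (auto simp: r_coset_def l_coset_def scalars2_def GL2_def mat_mul_left mat_mul_right)
  qed
qed

lemma group_PGL2: "group PGL2"
  unfolding PGL2_def by (rule normal.factorgroup_is_group[OF normal_scalars2])

lemma carrier_PGL2:
  "carrier PGL2 = {{mat c ** A | c. c \<noteq> 0} | A :: 'a::field ^ 2 ^ 2. invertible A}"
  by (auto simp: PGL2_def FactGroup_def RCOSETS_def r_coset_def scalars2_def GL2_def)


section \<open>Rational functions\<close>

text \<open>The value of a polynomial over the field \<open>K\<close> at an element of \<open>K(x)\<close>.\<close>

definition eval_ratfun :: "'a::field poly \<Rightarrow> 'a poly fract \<Rightarrow> 'a poly fract" where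
  "eval_ratfun p R = poly (map_poly (\<lambda>c. to_fract [:c:]) p) R"

text \<open>
  The composition \<open>Q(R)\<close>.  It is meaningful if \<open>R\<close> is not constant, since then no denominator of
  \<open>Q\<close> vanishes at \<open>R\<close>; see \<open>ratfun_compose_Fract\<close> and \<open>eval_ratfun_moebius_ratfun_nonzero\<close>.
\<close>

definition ratfun_compose :: "'a::field poly fract \<Rightarrow> 'a poly fract \<Rightarrow> 'a poly fract" where
  "ratfun_compose Q R =
     (let (p, q) = (SOME (p, q). q \<noteq> 0 \<and> Q = Fract p q) in eval_ratfun p R / eval_ratfun q R)"

definition adjoin_ratfun :: "'a::field poly fract \<Rightarrow> 'a poly fract set" where
  "adjoin_ratfun Q = {eval_ratfun p Q / eval_ratfun q Q | p q. eval_ratfun q Q \<noteq> 0}"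

text \<open>The polynomial \<open>h ^ degree F * F (g / h)\<close>; see \<open>rational_transform_eq\<close>.\<close>

definition rational_transform :: "'a::field poly \<Rightarrow> 'a poly \<Rightarrow> 'a poly \<Rightarrow> 'a poly" where
  "rational_transform F g h =
     (\<Sum>i\<le>degree F. smult (coeff F i) (g ^ i * h ^ (degree F - i)))"

lemma to_fract_const_mult: "to_fract [:c * d:] = to_fract [:c:] * to_fract [:d :: 'a::field:]"
  by (simp flip: to_fract_mult)

lemma eval_ratfun_0 [simp]: "eval_ratfun 0 R = 0"
  by (simp add: eval_ratfun_def)

lemma eval_ratfun_pCons [simp]:
  "eval_ratfun (pCons c p) R = to_fract [:c:] + R * eval_ratfun p R"
  by (cases "c = 0 \<and> p = 0") (auto simp: eval_ratfun_def map_poly_pCons)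

lemma eval_ratfun_add: "eval_ratfun (p + q) R = eval_ratfun p R + eval_ratfun q R"
  by (induction p q rule: poly_induct2) (simp_all add: algebra_simps flip: to_fract_add)

lemma eval_ratfun_smult: "eval_ratfun (smult c p) R = to_fract [:c:] * eval_ratfun p R"
  by (induction p) (simp_all add: algebra_simps to_fract_const_mult)

lemma eval_ratfun_mult: "eval_ratfun (p * q) R = eval_ratfun p R * eval_ratfun q R"
  by (induction p) (simp_all add: eval_ratfun_add eval_ratfun_smult algebra_simps)

lemma eval_ratfun_to_fract: "eval_ratfun p (to_fract r) = to_fract (pcompose p r)"
  by (induction p) (simp_all add: pcompose_pCons)

lemma rational_transform_eq:
  assumes "h \<noteq> 0"
  shows "to_fract (rational_transform F g h) =
           to_fract h ^ degree F * eval_ratfun F (Fract g h)"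
proof -
  have pow: "to_fract (p ^ i) = to_fract p ^ i" for p :: "'a poly" and i
    by (induction i) simp_all
  have "eval_ratfun F (Fract g h) =
          (\<Sum>i\<le>degree F. to_fract [:coeff F i:] * Fract g h ^ i)"
    by (simp add: eval_ratfun_def poly_altdef coeff_map_poly degree_map_poly)
  also have "to_fract h ^ degree F * \<dots> =
      (\<Sum>i\<le>degree F. to_fract (smult (coeff F i) (g ^ i * h ^ (degree F - i))))"
    unfolding sum_distrib_left
  proof (rule sum.cong)
    fix i assume "i \<in> {..degree F}"
    then have split: "to_fract h ^ degree F = to_fract h ^ i * to_fract h ^ (degree F - i)"
      by (simp flip: power_add)
    have cancel: "to_fract h ^ i * Fract g h ^ i = to_fract g ^ i"
      using assms by (simp add: Fract_conv_to_fract flip: power_mult_distrib)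
    have "to_fract h ^ degree F * (to_fract [:coeff F i:] * Fract g h ^ i) =
        to_fract [:coeff F i:] * ((to_fract h ^ i * Fract g h ^ i) * to_fract h ^ (degree F - i))"
      unfolding split by (simp only: ac_simps)
    also have "\<dots> = to_fract ([:coeff F i:] * (g ^ i * h ^ (degree F - i)))"
      by (simp only: cancel to_fract_mult pow)
    finally show "to_fract h ^ degree F * (to_fract [:coeff F i:] * Fract g h ^ i) =
        to_fract (smult (coeff F i) (g ^ i * h ^ (degree F - i)))"
      by simp
  qed simp
  also have "\<dots> = to_fract (rational_transform F g h)"
    by (simp add: rational_transform_def)
  finally show ?thesis by simp
qed

lemma ratfun_compose_Fract:
  assumes "\<And>r. r \<noteq> 0 \<Longrightarrow> eval_ratfun r R \<noteq> 0" and "q \<noteq> 0"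
  shows "ratfun_compose (Fract p q) R = eval_ratfun p R / eval_ratfun q R"
proof -
  obtain p' q' where eq: "(SOME (p', q'). q' \<noteq> 0 \<and> Fract p q = Fract p' q') = (p', q')"
    by fastforce
  have "case (p', q') of (p', q') \<Rightarrow> q' \<noteq> 0 \<and> Fract p q = Fract p' q'"
    unfolding eq[symmetric] by (rule someI[of _ "(p, q)"]) (use assms in auto)
  then have *: "q' \<noteq> 0" "p * q' = p' * q"
    using assms by (auto simp: eq_fract)
  then have "eval_ratfun p R * eval_ratfun q' R = eval_ratfun p' R * eval_ratfun q R"
    by (metis eval_ratfun_mult)
  with * assms show ?thesis
    by (simp add: ratfun_compose_def eq frac_eq_eq)
qed


section \<open>Actions of matrices\<close>

definition moebius_ratfun :: "'a::field ^ 2 ^ 2 \<Rightarrow> 'a poly fract" where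
  "moebius_ratfun A = Fract [:A$1$2, A$1$1:] [:A$2$2, A$2$1:]"

text \<open>
  The action on the projective line \<open>K \<union> {\<infinity>}\<close>, with \<open>None\<close> for \<open>\<infinity>\<close>.  The base field suffices:
  only the orbit of \<open>\<infinity>\<close> is needed, and the matrices have entries in \<open>K\<close>.
\<close>

fun moebius_point :: "'a::field ^ 2 ^ 2 \<Rightarrow> 'a option \<Rightarrow> 'a option" where
  "moebius_point A None = (if A$2$1 = 0 then None else Some (A$1$1 / A$2$1))"
| "moebius_point A (Some v) =
     (if A$2$1 * v + A$2$2 = 0 then None
      else Some ((A$1$1 * v + A$1$2) / (A$2$1 * v + A$2$2)))"

definition poly_act :: "'a::field ^ 2 ^ 2 \<Rightarrow> 'a poly \<Rightarrow> 'a poly" where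
  "poly_act A f =
     (let p = rational_transform f [:A$1$2, A$1$1:] [:A$2$2, A$2$1:]
      in smult (inverse (lead_coeff p)) p)"

lemma eval_ratfun_moebius_ratfun_nonzero:
  assumes "invertible A" and "r \<noteq> 0"
  shows "eval_ratfun r (moebius_ratfun A) \<noteq> 0"
proof -
  define a b c d where "a = A$1$1" and "b = A$1$2" and "c = A$2$1" and "d = A$2$2"
  note abcd = this
  have det: "a * d \<noteq> b * c"
    using assms(1) by (auto simp: invertible_det_nz det_2 abcd)
  have R: "moebius_ratfun A = Fract [:b, a:] [:d, c:]"
    by (simp add: moebius_ratfun_def abcd)
  show ?thesis
  proof (cases "c = 0")
    case True
    with det have "a \<noteq> 0" "d \<noteq> 0" by auto
    then have "moebius_ratfun A = to_fract [:b / d, a / d:]"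
      using True by (simp add: R to_fract_def eq_fract)
    moreover have "pcompose r [:b / d, a / d:] \<noteq> 0"
      using \<open>a \<noteq> 0\<close> \<open>d \<noteq> 0\<close> assms(2) by (subst pcompose_eq_0_iff) auto
    ultimately show ?thesis by (simp add: eval_ratfun_to_fract)
  next
    case False
    define n where "n = degree r"
    have "poly (rational_transform r [:b, a:] [:d, c:]) (- d / c) =
        (\<Sum>i\<le>n. if i = n then coeff r i * (b - d * a / c) ^ i else 0)"
      unfolding rational_transform_def n_def[symmetric] poly_sum
      by (rule sum.cong) (use False in \<open>auto simp: power_0_left\<close>)
    also have "\<dots> = lead_coeff r * (b - d * a / c) ^ n"
      by (simp add: n_def)
    also have "\<dots> \<noteq> 0"
      using assms(2) det False by (auto simp: field_simps)
    finally have "rational_transform r [:b, a:] [:d, c:] \<noteq> 0" by auto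
    then show ?thesis
      using rational_transform_eq[of "[:d, c:]" r "[:b, a:]"] False R by auto
  qed
qed


section \<open>Quotient maps\<close>

definition invariant_ratfuns :: "('a::field ^ 2 ^ 2) set set \<Rightarrow> 'a poly fract set" where
  "invariant_ratfuns G = {Q. \<forall>A\<in>\<Union>G. ratfun_compose Q (moebius_ratfun A) = Q}"

text \<open>
  A rational function \<open>g / h\<close> is given by the pair \<open>g\<close>, \<open>h\<close>, which is determined by it because
  \<open>g\<close> and \<open>h\<close> are coprime and \<open>g\<close> is monic.
\<close>

definition quotient_map ::
    "('a::field ^ 2 ^ 2) set set \<Rightarrow> 'a poly \<Rightarrow> 'a poly \<Rightarrow> bool" where
  "quotient_map G g h \<longleftrightarrow>
     h \<noteq> 0 \<and> coprime g h \<and> lead_coeff g = 1 \<and> degree g = card G \<and> degree h < degree g \<and>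
     invariant_ratfuns G = adjoin_ratfun (Fract g h)"


section \<open>Monic irreducible polynomials\<close>

definition monic_irreducibles :: "'a::field poly set" where
  "monic_irreducibles = {f. irreducible f \<and> lead_coeff f = 1}"

definition monic_irreducibles_deg :: "nat \<Rightarrow> 'a::field poly set" where
  "monic_irreducibles_deg n = {f \<in> monic_irreducibles. degree f = n}"

definition C_set ::
    "('a::field ^ 2 ^ 2) set set \<Rightarrow> 'a poly \<Rightarrow> 'a poly \<Rightarrow> nat \<Rightarrow> 'a poly set" where
  "C_set G g h n =
     {f \<in> monic_irreducibles_deg n.
        rational_transform f g h \<in> monic_irreducibles_deg (card G * n)}"

definition D_set ::
    "('a::field ^ 2 ^ 2) set set \<Rightarrow> 'a poly \<Rightarrow> 'a poly \<Rightarrow> nat \<Rightarrow> 'a poly set" where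
  "D_set G g h n = monic_irreducibles_deg n - C_set G g h n"

definition orbit_infinity :: "('a::field ^ 2 ^ 2) set set \<Rightarrow> 'a option set" where
  "orbit_infinity G = {moebius_point A None | A. A \<in> \<Union>G}"

definition monic_irreducibles_avoiding :: "('a::field ^ 2 ^ 2) set set \<Rightarrow> 'a poly set" where
  "monic_irreducibles_avoiding G =
     {r \<in> monic_irreducibles. \<forall>v. Some v \<in> orbit_infinity G \<longrightarrow> poly r v \<noteq> 0}"

definition poly_orbit :: "('a::field ^ 2 ^ 2) set set \<Rightarrow> 'a poly \<Rightarrow> 'a poly set" where
  "poly_orbit G r = {poly_act A r | A. A \<in> \<Union>G}"

definition exceptional_polys ::
    "('a::field ^ 2 ^ 2) set set \<Rightarrow> 'a poly \<Rightarrow> 'a poly \<Rightarrow> 'a poly set" where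
  "exceptional_polys G g h =
     {F \<in> monic_irreducibles. \<exists>r \<in> monic_irreducibles_avoiding G. \<exists>k>1.
        rational_transform F g h = (\<Prod>t\<in>poly_orbit G r. t) ^ k}"

text \<open>
  The invariant \<open>d(G)\<close>, which does not depend on the choice of the quotient map \<open>g / h\<close>.
\<close>

definition d_inv :: "('a::field ^ 2 ^ 2) set set \<Rightarrow> 'a poly \<Rightarrow> 'a poly \<Rightarrow> nat" where
  "d_inv G g h =
     (if exceptional_polys G g h = {} then 0 else Max (degree ` exceptional_polys G g h))"

end

theory Submission
  imports "HOL-Algebra.Algebraic_Closure_Type" Defs
begin

text \<open>
  Work over the algebraic closure of the field with \<open>q\<close> elements, where the degree of a point is its
  period under \<open>x \<mapsto> x\<^sup>q\<close> and a monic irreducible polynomial of degree \<open>n\<close> is a Frobenius orbit of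
  \<open>n\<close> points.  The equation \<open>g(t) h(x) - g(x) h(t) = h(x) \<Prod> (t - A x)\<close>, with \<open>A\<close> ranging over \<open>G\<close>,
  shows that the fibres of \<open>Q = g / h\<close> are the \<open>G\<close>-orbits.  As \<open>|G| = s\<close> is prime, a fibre has \<open>s\<close>
  points or is a single point fixed by \<open>G\<close>; the latter makes the minimal polynomial of \<open>Q(x)\<close>
  exceptional, so it does not occur in degrees above \<open>d(G)\<close>.  Frobenius commutes with \<open>G\<close>, hence
  the points of a fibre with \<open>s\<close> elements over a point of degree \<open>m\<close> either all have degree \<open>s m\<close>
  (elements of \<open>C\<close>) or all have degree \<open>m\<close> (elements of \<open>D\<close>).  Counting the points
  \<open>x\<close> of degree \<open>n\<close> by the degree of \<open>Q(x)\<close> gives \<open>|C(n)| + |D(n)| = s |D(n)| + |C(n / s)|\<close>, where the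
  last term is absent unless \<open>s\<close> divides \<open>n\<close>.
\<close>

no_notation fps_nth (infixl \<open>$\<close> 75)


section \<open>Homomorphisms and polynomials over infinite fields\<close>

lemma map_poly_hom_add:
  assumes "f 0 = 0" and "\<And>x y. f (x + y) = f x + f y"
  shows "map_poly f (p + q) = map_poly f p + map_poly f q"
  by (rule poly_eqI) (simp add: coeff_map_poly assms)

lemma map_poly_hom_mult:
  fixes f :: "'a::comm_semiring_0 \<Rightarrow> 'b::comm_semiring_0"
  assumes "f 0 = 0" and "\<And>x y. f (x + y) = f x + f y" and "\<And>x y. f (x * y) = f x * f y"
  shows "map_poly f (p * q) = map_poly f p * map_poly f q"
proof (induction p)
  case (pCons a p)
  then show ?case
    by (simp add: map_poly_pCons map_poly_hom_add[OF assms(1,2)] map_poly_smult assms)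
qed simp

lemma map_poly_hom_prod:
  fixes f :: "'a::comm_semiring_1 \<Rightarrow> 'b::comm_semiring_1"
  assumes "f 0 = 0" and "f 1 = 1"
    and "\<And>x y. f (x + y) = f x + f y" and "\<And>x y. f (x * y) = f x * f y"
  shows "map_poly f (prod P A) = (\<Prod>i\<in>A. map_poly f (P i))"
  by (induction A rule: infinite_finite_induct) (simp_all add: map_poly_hom_mult assms)

text \<open>If the field were finite, adding 1 to the product of all \<open>x - a\<close> would give
  a nonconstant polynomial without a root.\<close>

lemma infinite_UNIV_alg_closed: "infinite (UNIV :: 'a::alg_closed_field set)"
proof
  assume fin: "finite (UNIV :: 'a set)"
  define p where "p = (\<Prod>a\<in>(UNIV :: 'a set). [:-a, 1:])"
  have deg: "degree p = card (UNIV :: 'a set)"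
    by (simp add: p_def degree_prod_eq_sum_degree)
  have "card (UNIV :: 'a set) > 0" using fin by (simp add: finite_UNIV_card_ge_0)
  then have "degree (p + 1) > 0" using deg by (simp add: degree_add_eq_left)
  then obtain x where "poly (p + 1) x = 0" using alg_closed_imp_poly_has_root by blast
  moreover have "poly p x = 0" using fin by (simp add: p_def poly_prod)
  ultimately show False by simp
qed

text \<open>A nonzero difference would have infinitely many roots. The set \<open>S\<close> absorbs
  the points where a generic argument breaks down; with \<open>S = {}\<close>, equality of all
  values gives equality of polynomials.\<close>

lemma poly_eq_if_cofinitely_eq:
  fixes p q :: "'a::alg_closed_field poly"
  assumes "finite S" and "\<And>x. x \<notin> S \<Longrightarrow> poly p x = poly q x"
  shows "p = q"
proof (rule ccontr)
  assume "p \<noteq> q"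
  then have "finite {x. poly (p - q) x = 0}" by (intro poly_roots_finite) simp
  moreover have "UNIV - S \<subseteq> {x. poly (p - q) x = 0}" using assms(2) by auto
  ultimately have "finite (UNIV - S)" by (rule rev_finite_subset)
  then have "finite (UNIV :: 'a set)" using assms(1) by (simp add: Diff_infinite_finite)
  then show False using infinite_UNIV_alg_closed by blast
qed


section \<open>Polynomials over a field at points of the algebraic closure\<close>

definition lift_ac :: "'a::field poly \<Rightarrow> 'a alg_closure poly" where
  "lift_ac = map_poly to_ac"

abbreviation aeval :: "'a::field poly \<Rightarrow> 'a alg_closure \<Rightarrow> 'a alg_closure" where
  "aeval p \<equiv> poly (lift_ac p)"

lemma coeff_lift_ac [simp]: "coeff (lift_ac p) i = to_ac (coeff p i)"
  by (simp add: lift_ac_def coeff_map_poly)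

lemma degree_lift_ac [simp]: "degree (lift_ac p) = degree p"
  by (simp add: lift_ac_def degree_map_poly)

lemma lift_ac_0 [simp]: "lift_ac 0 = 0"
  and lift_ac_1 [simp]: "lift_ac 1 = 1"
  and lift_ac_pCons [simp]: "lift_ac (pCons a p) = pCons (to_ac a) (lift_ac p)"
  by (simp_all add: lift_ac_def map_poly_pCons)

lemma lift_ac_add [simp]: "lift_ac (p + q) = lift_ac p + lift_ac q"
  by (rule poly_eqI) simp

lemma lift_ac_smult [simp]: "lift_ac (smult c p) = smult (to_ac c) (lift_ac p)"
  by (rule poly_eqI) simp

lemma lift_ac_mult [simp]: "lift_ac (p * q) = lift_ac p * lift_ac q"
  by (simp add: lift_ac_def map_poly_hom_mult)

lemma lift_ac_power [simp]: "lift_ac (p ^ n) = lift_ac p ^ n"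
  by (induction n) simp_all

lemma lift_ac_sum [simp]: "lift_ac (sum P A) = (\<Sum>i\<in>A. lift_ac (P i))"
  by (induction A rule: infinite_finite_induct) simp_all

lemma lift_ac_eq_iff [simp]: "lift_ac p = lift_ac q \<longleftrightarrow> p = q"
  by (simp add: poly_eq_iff)

lemma lift_ac_eq_0_iff [simp]: "lift_ac p = 0 \<longleftrightarrow> p = 0"
  by (simp add: poly_eq_iff)

lemma aeval_root_exists:
  assumes "degree p > 0"
  shows "\<exists>x. aeval p x = 0"
  using assms by (intro alg_closed_imp_poly_has_root) simp

lemma finite_aeval_roots: "p \<noteq> 0 \<Longrightarrow> finite {x. aeval p x = 0}"
  by (intro poly_roots_finite) simp


section \<open>The Frobenius map\<close>

lemma finite_field_power_card:
  fixes a :: "'a::{field, finite}"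
  shows "a ^ CARD('a) = a"
proof (cases "a = 0")
  case False
  \<comment> \<open>Multiplication by \<open>a\<close> permutes the nonzero elements, so their
    product picks up the factor \<open>a ^ (q - 1)\<close> without changing.\<close>
  have "(\<Prod>x\<in>UNIV - {0}. a * x) = \<Prod>(UNIV - {0 :: 'a})"
    by (rule prod.reindex_bij_witness[of _ "\<lambda>x. x / a" "\<lambda>x. a * x"]) (use False in auto)
  then have "a ^ (CARD('a) - 1) = 1"
    by (simp add: prod.distrib card_Diff_singleton)
  then show ?thesis
    using power_minus_mult[of "CARD('a)" a] by (simp add: finite_UNIV_card_ge_0)
qed (simp add: finite_UNIV_card_ge_0)

definition frob :: "'a::{field, finite} alg_closure \<Rightarrow> 'a alg_closure" where
  "frob x = x ^ CARD('a)"

lemma frob_0 [simp]: "frob 0 = 0"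
  and frob_1 [simp]: "frob 1 = 1"
  and frob_mult [simp]: "frob (x * y) = frob x * frob y"
  and frob_divide [simp]: "frob (x / y) = frob x / frob y"
  and frob_eq_0_iff [simp]: "frob x = 0 \<longleftrightarrow> x = 0"
  by (simp_all add: frob_def finite_UNIV_card_ge_0 power_mult_distrib power_divide)

lemma frob_to_ac [simp]: "frob (to_ac a) = to_ac a"
  by (simp add: frob_def finite_field_power_card flip: to_ac_power)

text \<open>
  The two sides of \<open>(x + 1)\<^sup>q = x\<^sup>q + 1\<close> have degree \<open>q\<close>, the same leading coefficient and the same
  values on the \<open>q\<close> elements of the field, so it is an identity of polynomials.
\<close>

lemma frob_add [simp]: "frob (x + y) = frob x + frob y"
proof (cases "y = 0")
  case False
  have "[:1, 1 :: 'a:] ^ CARD('a) = monom 1 (CARD('a)) + 1"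
  proof (rule poly_eqI_degree_lead_coeff[of _ "CARD('a)" _ UNIV])
    show "coeff ([:1, 1 :: 'a:] ^ CARD('a)) CARD('a) = coeff (monom 1 CARD('a) + 1) CARD('a)"
      by (simp add: coeff_linear_power finite_UNIV_card_ge_0)
    show "degree (monom (1 :: 'a) CARD('a) + 1) \<le> CARD('a)"
      by (intro degree_add_le) (auto simp: degree_monom_le)
  qed (auto simp: degree_linear_power poly_monom finite_field_power_card)
  then have "aeval ([:1, 1 :: 'a:] ^ CARD('a)) (x / y) = aeval (monom 1 CARD('a) + 1) (x / y)"
    by simp
  moreover have "lift_ac (monom (1 :: 'a) CARD('a)) = monom 1 CARD('a)"
    by (rule poly_eqI) simp
  ultimately have "frob (x / y + 1) = frob (x / y) + 1"
    by (simp add: frob_def poly_monom add.commute)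
  \<comment> \<open>Multiplying by \<open>frob y\<close> passes from adding 1 to adding an arbitrary
    nonzero \<open>y\<close>.\<close>
  then have "frob (y * (x / y + 1)) = frob y * (frob (x / y) + 1)" by (simp only: frob_mult)
  then show ?thesis using False by (simp add: field_simps)
qed simp

lemma frob_minus [simp]: "frob (- x) = - frob x"
  using frob_add[of x "- x"] by (simp add: eq_neg_iff_add_eq_0 add.commute)

lemma inj_frob: "inj frob"
proof (rule injI)
  fix x y :: "'a alg_closure"
  assume "frob x = frob y"
  then have "frob (x + - y) = 0" by (simp only: frob_add frob_minus) simp
  then show "x = y" by simp
qed

lemma frob_pow_0 [simp]: "(frob ^^ k) 0 = 0"
  and frob_pow_to_ac [simp]: "(frob ^^ k) (to_ac a) = to_ac a"
  and frob_pow_add [simp]: "(frob ^^ k) (x + y) = (frob ^^ k) x + (frob ^^ k) y"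
  and frob_pow_minus [simp]: "(frob ^^ k) (- x) = - (frob ^^ k) x"
  and frob_pow_mult [simp]: "(frob ^^ k) (x * y) = (frob ^^ k) x * (frob ^^ k) y"
  and frob_pow_divide [simp]: "(frob ^^ k) (x / y) = (frob ^^ k) x / (frob ^^ k) y"
  by (induction k) simp_all

lemma frob_pow_eq_iff [simp]: "(frob ^^ k) x = (frob ^^ k) y \<longleftrightarrow> x = y"
  using inj_fn[OF inj_frob, of k] by (auto dest: injD)

lemma frob_pow_eq_pow_iff:
  assumes "i \<le> j"
  shows "(frob ^^ i) x = (frob ^^ j) x \<longleftrightarrow> (frob ^^ (j - i)) x = x"
proof -
  have "(frob ^^ j) x = (frob ^^ (i + (j - i))) x" using assms by simp
  then have "(frob ^^ j) x = (frob ^^ i) ((frob ^^ (j - i)) x)" by (simp only: funpow_add comp_apply)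
  then show ?thesis by (metis frob_pow_eq_iff)
qed

lemma frob_pow_commute: "(frob ^^ i) ((frob ^^ j) x) = (frob ^^ j) ((frob ^^ i) x)"
  by (metis add.commute comp_apply funpow_add)

lemma aeval_frob_pow: "aeval p ((frob ^^ k) x) = (frob ^^ k) (aeval p x)"
  by (induction p) simp_all

text \<open>The fixed points are the roots of \<open>x ^ q - x\<close>. There are at most
  \<open>q\<close> of them, and the base field already supplies \<open>q\<close>.\<close>

lemma frob_fixed_iff: "frob x = x \<longleftrightarrow> x \<in> range to_ac"
proof
  define q where "q = CARD('a)"
  assume fixed: "frob x = x"
  define p :: "'a alg_closure poly" where "p = monom 1 q + [:0, -1:]"
  have "card {0, 1 :: 'a} \<le> q" unfolding q_def by (rule card_mono) auto
  then have q: "q \<ge> 2" by simp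
  then have deg: "degree p = q"
    unfolding p_def by (subst degree_add_eq_left) (auto simp: degree_monom_eq)
  then have "p \<noteq> 0" using q by auto
  have root: "poly p y = 0 \<longleftrightarrow> frob y = y" for y
    by (simp add: p_def poly_monom frob_def q_def)
  show "x \<in> range to_ac"
  proof (rule ccontr)
    assume "x \<notin> range to_ac"
    then have "card (insert x (range (to_ac :: 'a \<Rightarrow> _))) = Suc q"
      by (simp add: card_image inj_to_ac q_def)
    moreover have "card (insert x (range (to_ac :: 'a \<Rightarrow> _))) \<le> card {y. poly p y = 0}"
      using fixed \<open>p \<noteq> 0\<close> by (intro card_mono poly_roots_finite) (auto simp: root)
    moreover have "card {y. poly p y = 0} \<le> q"
      using card_poly_roots_bound[OF \<open>p \<noteq> 0\<close>] deg by simp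
    ultimately show False by simp
  qed
qed auto

section \<open>Periods of points under Frobenius\<close>

definition period :: "'a::{field, finite} alg_closure \<Rightarrow> nat" where
  "period x = (LEAST k. k > 0 \<and> (frob ^^ k) x = x)"

text \<open>Frobenius preserves the finite root set of any polynomial over the base field that
  vanishes at \<open>x\<close>. The orbit therefore repeats, and injectivity brings the repetition
  back to \<open>x\<close> itself.\<close>

lemma frob_periodic: "\<exists>k>0. (frob ^^ k) x = x"
proof -
  obtain p where p: "p \<noteq> 0" "aeval p x = 0"
    using alg_closure_algebraic[of x] by (auto simp: lift_ac_def)
  have "range (\<lambda>i. (frob ^^ i) x) \<subseteq> {y. aeval p y = 0}"
    using p(2) by (auto simp: aeval_frob_pow)
  then have "finite (range (\<lambda>i. (frob ^^ i) x))"
    using finite_aeval_roots[OF p(1)] by (rule finite_subset)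
  then have "\<not> inj (\<lambda>i. (frob ^^ i) x)" using finite_imageD by blast
  then obtain i j where "i < j" "(frob ^^ i) x = (frob ^^ j) x"
    by (auto simp: inj_on_def elim: linorder_neqE_nat)
  then have "(frob ^^ (j - i)) x = x" by (simp add: frob_pow_eq_pow_iff)
  with \<open>i < j\<close> show ?thesis by (intro exI[of _ "j - i"]) auto
qed

lemma period_pos [simp]: "period x > 0"
  and frob_pow_period [simp]: "(frob ^^ period x) x = x"
  using LeastI_ex[OF frob_periodic[of x]] by (simp_all add: period_def)

lemma period_nonzero [simp]: "period x \<noteq> 0"
  using period_pos[of x] by (rule gr_implies_not0)

lemma frob_pow_fixed_iff: "(frob ^^ k) x = x \<longleftrightarrow> period x dvd k"
proof
  assume "(frob ^^ k) x = x"
  then have "(frob ^^ (k mod period x)) x = x" by (simp add: funpow_mod_eq)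
  moreover have "k mod period x < period x" by simp
  ultimately have "k mod period x = 0"
    using not_less_Least[of "k mod period x" "\<lambda>k. k > 0 \<and> (frob ^^ k) x = x"]
    by (auto simp flip: period_def)
  then show "period x dvd k" by auto
next
  assume "period x dvd k"
  then show "(frob ^^ k) x = x"
    using funpow_mod_eq[of "period x" frob x k] by simp
qed

lemma period_frob_pow [simp]: "period ((frob ^^ k) x) = period x"
proof -
  have "(frob ^^ j) ((frob ^^ k) x) = (frob ^^ k) x \<longleftrightarrow> (frob ^^ j) x = x" for j
    by (simp add: frob_pow_commute[of j k])
  then show ?thesis by (simp add: period_def)
qed


section \<open>Minimal polynomials and monic irreducible polynomials\<close>

lemma inj_on_frob_orbit: "inj_on (\<lambda>i. (frob ^^ i) x) {..<period x}"
proof -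
  have *: "(frob ^^ i) x \<noteq> (frob ^^ j) x" if "i < j" "j < period x" for i j
  proof
    assume "(frob ^^ i) x = (frob ^^ j) x"
    then have "period x dvd j - i"
      using that by (simp add: frob_pow_eq_pow_iff frob_pow_fixed_iff)
    with that show False by (auto dest: dvd_imp_le)
  qed
  show ?thesis
  proof (rule inj_onI)
    fix i j
    assume "i \<in> {..<period x}" "j \<in> {..<period x}" "(frob ^^ i) x = (frob ^^ j) x"
    then show "i = j" using *[of i j] *[of j i] by (cases i j rule: linorder_cases) auto
  qed
qed

text \<open>Applying \<open>of_ac\<close> loses nothing because the product has coefficients in the
  base field, as \<open>lift_ac_minpoly\<close> shows.\<close>

definition minpoly :: "'a::{field, finite} alg_closure \<Rightarrow> 'a poly" where
  "minpoly x = map_poly of_ac (\<Prod>i<period x. [:- (frob ^^ i) x, 1:])"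

text \<open>Frobenius permutes the linear factors cyclically, so it fixes every coefficient of the
  product; hence these lie in the base field.\<close>

lemma lift_ac_minpoly: "lift_ac (minpoly x) = (\<Prod>i<period x. [:- (frob ^^ i) x, 1:])"
proof -
  define P where "P k = (\<Prod>i<k. [:- (frob ^^ i) x, 1:])" for k
  have "map_poly frob (P k) = (\<Prod>i<k. [:- (frob ^^ Suc i) x, 1:])" for k
    by (simp add: P_def map_poly_hom_prod map_poly_pCons)
  \<comment> \<open>Prepending the factor of \<open>x\<close> to the shifted product gives
    \<open>P (Suc (period x))\<close>, whose last factor is again that of \<open>x\<close>.
    Cancelling it avoids reindexing modulo the period.\<close>
  then have "[:- x, 1:] * map_poly frob (P (period x)) = P (Suc (period x))"
    by (simp add: P_def prod.lessThan_Suc_shift del: prod.lessThan_Suc)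
  also have "\<dots> = [:- x, 1:] * P (period x)" by (simp add: P_def mult.commute)
  finally have "map_poly frob (P (period x)) = P (period x)"
    by (subst (asm) mult_cancel_left) auto
  then have "frob (coeff (P (period x)) i) = coeff (P (period x)) i" for i
    by (metis coeff_map_poly frob_0)
  then have "to_ac (of_ac (coeff (P (period x)) i)) = coeff (P (period x)) i" for i
    by (simp add: frob_fixed_iff to_ac_of_ac)
  then have "lift_ac (map_poly of_ac (P (period x))) = P (period x)"
    by (intro poly_eqI) (simp add: coeff_map_poly)
  then show ?thesis by (simp add: minpoly_def P_def)
qed

lemma degree_minpoly [simp]: "degree (minpoly x) = period x"
proof -
  have "degree (lift_ac (minpoly x)) = period x"
    unfolding lift_ac_minpoly by (subst degree_prod_eq_sum_degree) auto
  then show ?thesis by simp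
qed

lemma minpoly_nonzero [simp]: "minpoly x \<noteq> 0"
  using degree_minpoly[of x] period_pos[of x] by (metis degree_0 less_irrefl)

lemma lead_coeff_minpoly [simp]: "coeff (minpoly x) (period x) = 1"
proof -
  have "lead_coeff (lift_ac (minpoly x)) = 1"
    unfolding lift_ac_minpoly by (simp add: lead_coeff_prod)
  then have "to_ac (coeff (minpoly x) (period x)) = 1" by simp
  then show ?thesis by simp
qed

lemma aeval_minpoly_eq_0_iff: "aeval (minpoly x) y = 0 \<longleftrightarrow> y \<in> (\<lambda>i. (frob ^^ i) x) ` {..<period x}"
  by (auto simp: lift_ac_minpoly poly_prod)

lemma aeval_minpoly [simp]: "aeval (minpoly x) x = 0"
  unfolding aeval_minpoly_eq_0_iff by (rule image_eqI[of _ _ 0]) auto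

text \<open>The remainder modulo \<open>minpoly x\<close> vanishes on all \<open>period x\<close>
  conjugates of \<open>x\<close>, more points than its degree allows.\<close>

lemma minpoly_dvd:
  assumes "aeval p x = 0"
  shows "minpoly x dvd p"
proof -
  define r where "r = p mod minpoly x"
  have "p = minpoly x * (p div minpoly x) + r" by (simp add: r_def)
  from arg_cong[OF this, of lift_ac]
  have "aeval p y = aeval (minpoly x) y * aeval (p div minpoly x) y + aeval r y" for y
    by simp
  from this[of "(frob ^^ i) x" for i] have root: "aeval r ((frob ^^ i) x) = 0" for i
    using assms by (simp add: aeval_frob_pow)
  have "r = 0"
  proof (rule ccontr)
    assume "r \<noteq> 0"
    then have "card ((\<lambda>i. (frob ^^ i) x) ` {..<period x}) \<le> card {y. aeval r y = 0}"
      using root by (intro card_mono finite_aeval_roots) auto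
    also have "\<dots> \<le> degree r"
      using card_poly_roots_bound[of "lift_ac r"] \<open>r \<noteq> 0\<close> by simp
    also have "\<dots> < period x"
      using degree_mod_less'[of "minpoly x" p] \<open>r \<noteq> 0\<close> by (simp add: r_def)
    finally show False by (simp add: card_image inj_on_frob_orbit)
  qed
  then show ?thesis by (simp add: r_def dvd_eq_mod_eq_0)
qed

text \<open>In a factorization one factor vanishes at \<open>x\<close>, hence is a multiple of
  \<open>minpoly x\<close>, and the degrees leave a constant for the other.\<close>

lemma irreducible_minpoly: "irreducible (minpoly x)"
proof (rule irreducibleI)
  show "\<not> is_unit (minpoly x)" by (simp add: is_unit_iff_degree)
  fix a b
  assume eq: "minpoly x = a * b"
  then have nz: "a \<noteq> 0" "b \<noteq> 0" using minpoly_nonzero[of x] by (auto simp del: minpoly_nonzero)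
  have "aeval a x * aeval b x = 0"
    using aeval_minpoly[of x] by (simp add: eq del: aeval_minpoly)
  then have "minpoly x dvd a \<or> minpoly x dvd b" by (auto intro: minpoly_dvd)
  then have "degree (minpoly x) \<le> degree a \<or> degree (minpoly x) \<le> degree b"
    using nz by (auto dest: dvd_imp_degree_le)
  moreover have "degree (minpoly x) = degree a + degree b"
    unfolding eq using nz by (rule degree_mult_eq)
  ultimately show "is_unit a \<or> is_unit b" using nz by (auto simp: is_unit_iff_degree)
qed simp

lemma minpoly_monic_irreducible: "minpoly x \<in> monic_irreducibles"
  by (simp add: monic_irreducibles_def irreducible_minpoly)

lemma minpoly_monic_irreducible_deg: "minpoly x \<in> monic_irreducibles_deg n \<longleftrightarrow> period x = n"
  by (simp add: monic_irreducibles_deg_def minpoly_monic_irreducible)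

lemma monic_dvd_same_degree_eq:
  fixes p q :: "'a::field poly"
  assumes "p dvd q" and "degree p = degree q" and "lead_coeff p = 1" and "lead_coeff q = 1"
  shows "p = q"
proof -
  obtain c where c: "q = p * c" using assms(1) by auto
  with assms(4) have "p \<noteq> 0" "c \<noteq> 0" by auto
  with c assms(2) have "degree c = 0" by (simp add: degree_mult_eq)
  then obtain a where "c = [:a:]" by (rule degree_eq_zeroE)
  with c assms(3,4) have "a = 1" by (metis lead_coeff_mult lead_coeff_pCons(2) mult_1 pCons_0_0)
  with c \<open>c = [:a:]\<close> show ?thesis by simp
qed

lemma monic_irreducible_eq_minpoly:
  assumes f: "f \<in> monic_irreducibles" and "aeval f x = 0"
  shows "f = minpoly x"
proof -
  have "minpoly x dvd f" by (rule minpoly_dvd) fact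
  then obtain c where c: "f = minpoly x * c" by auto
  have irr: "irreducible f" and "lead_coeff f = 1" using f by (auto simp: monic_irreducibles_def)
  have "\<not> is_unit (minpoly x)" by (simp add: is_unit_iff_degree)
  then have "is_unit c" using irreducibleD[OF irr c] by blast
  have "c \<noteq> 0" using irr c by auto
  with \<open>is_unit c\<close> have "degree c = 0" by (simp add: is_unit_iff_degree)
  with \<open>c \<noteq> 0\<close> have "degree (minpoly x) = degree f" by (subst c, subst degree_mult_eq) auto
  moreover have "lead_coeff (minpoly x) = 1" by simp
  ultimately show ?thesis
    using \<open>minpoly x dvd f\<close> \<open>lead_coeff f = 1\<close> monic_dvd_same_degree_eq by metis
qed

lemma monic_irreducible_obtains_root:
  assumes "f \<in> monic_irreducibles"
  obtains x where "f = minpoly x"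
proof -
  have "\<not> is_unit f" "f \<noteq> 0" using assms irreducible_not_unit by (auto simp: monic_irreducibles_def)
  then have "degree f > 0" by (simp add: is_unit_iff_degree)
  then obtain x where "aeval f x = 0" using aeval_root_exists by blast
  then show thesis using that monic_irreducible_eq_minpoly[OF assms] by blast
qed

lemma minpoly_eq_iff: "minpoly x = minpoly y \<longleftrightarrow> x \<in> (\<lambda>i. (frob ^^ i) y) ` {..<period y}"
  unfolding aeval_minpoly_eq_0_iff[symmetric]
  using aeval_minpoly[of x] monic_irreducible_eq_minpoly[OF minpoly_monic_irreducible, of y x]
  by metis

text \<open>This converts counts of polynomials into counts of points: each polynomial in
  \<open>S\<close> is the minimal polynomial of exactly one Frobenius orbit, which has
  \<open>n\<close> elements.\<close>

lemma card_minpoly_vimage: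
  assumes "S \<subseteq> monic_irreducibles_deg n" and "finite S"
  shows "finite (minpoly -` S)" and "card (minpoly -` S) = n * card S"
proof -
  have fibre: "finite {x. minpoly x = f} \<and> card {x. minpoly x = f} = n" if "f \<in> S" for f
  proof -
    have "f \<in> monic_irreducibles" "degree f = n"
      using that assms(1) by (auto simp: monic_irreducibles_deg_def)
    then obtain y where y: "f = minpoly y" "period y = n"
      using degree_minpoly monic_irreducible_obtains_root by metis
    then have "{x. minpoly x = f} = (\<lambda>i. (frob ^^ i) y) ` {..<n}"
      by (auto simp: minpoly_eq_iff)
    with y show ?thesis using inj_on_frob_orbit[of y] by (simp add: card_image)
  qed
  have eq: "minpoly -` S = (\<Union>f\<in>S. {x. minpoly x = f})" by auto
  show "finite (minpoly -` S)" unfolding eq using fibre assms(2) by auto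
  have "card (minpoly -` S) = (\<Sum>f\<in>S. card {x. minpoly x = f})"
    unfolding eq using fibre assms(2) by (intro card_UN_disjoint) auto
  then show "card (minpoly -` S) = n * card S" using fibre by simp
qed

lemma finite_monic_irreducibles_deg:
  "finite (monic_irreducibles_deg n :: 'a::{field, finite} poly set)"
proof (rule finite_subset)
  show "monic_irreducibles_deg n \<subseteq> Poly ` {xs :: 'a list. set xs \<subseteq> UNIV \<and> length xs = Suc n}"
  proof
    fix f :: "'a poly"
    assume "f \<in> monic_irreducibles_deg n"
    then have "degree f = n" "f \<noteq> 0" by (auto simp: monic_irreducibles_deg_def monic_irreducibles_def)
    then have "f = Poly (coeffs f)" "length (coeffs f) = Suc n"
      by (simp_all add: length_coeffs_degree)
    then show "f \<in> Poly ` {xs :: 'a list. set xs \<subseteq> UNIV \<and> length xs = Suc n}" by blast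
  qed
qed (intro finite_imageI finite_lists_length_eq, simp)


section \<open>Rational transforms at points\<close>

lemma aeval_rational_transform:
  "aeval (rational_transform F u v) x =
     (\<Sum>i\<le>degree F. to_ac (coeff F i) * aeval u x ^ i * aeval v x ^ (degree F - i))"
  by (simp add: rational_transform_def poly_sum mult.assoc)

lemma aeval_rational_transform_nonzero:
  assumes "aeval v x \<noteq> 0"
  shows "aeval (rational_transform F u v) x =
    aeval v x ^ degree F * aeval F (aeval u x / aeval v x)"
proof -
  have "aeval F (aeval u x / aeval v x) =
      (\<Sum>i\<le>degree F. to_ac (coeff F i) * (aeval u x / aeval v x) ^ i)"
    by (simp add: poly_altdef)
  then show ?thesis
    unfolding aeval_rational_transform
    using assms by (simp add: sum_distrib_left power_divide power_diff mult_ac)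
qed

text \<open>Where \<open>v\<close> vanishes, only the term with \<open>v ^ 0\<close>
  survives.\<close>

lemma aeval_rational_transform_zero:
  assumes "aeval v x = 0"
  shows "aeval (rational_transform F u v) x = to_ac (lead_coeff F) * aeval u x ^ degree F"
proof -
  have "aeval (rational_transform F u v) x =
      (\<Sum>i\<le>degree F. if i = degree F then to_ac (lead_coeff F) * aeval u x ^ degree F else 0)"
    unfolding aeval_rational_transform by (rule sum.cong) (use assms in \<open>auto simp: power_0_left\<close>)
  then show ?thesis by simp
qed

text \<open>The transform is the homogenization of \<open>F\<close>, so a splitting of
  \<open>F\<close> carries over to it. Unlike the formula with the quotient \<open>u / v\<close>,
  this holds at zeros of \<open>v\<close> too.\<close>

lemma aeval_rational_transform_split:
  fixes n :: nat
  assumes "lift_ac F = (\<Prod>i<n. [:- z i, 1:])"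
  shows "aeval (rational_transform F u v) x = (\<Prod>i<n. aeval u x - z i * aeval v x)"
proof -
  have deg: "degree F = n"
    using arg_cong[OF assms, of degree] by (simp add: degree_prod_eq_sum_degree)
  have "lead_coeff (lift_ac F) = 1" unfolding assms by (simp add: lead_coeff_prod)
  then have lc: "coeff F n = 1" using deg by simp
  show ?thesis
  proof (cases "aeval v x = 0")
    case True
    then show ?thesis by (simp add: aeval_rational_transform_zero deg lc)
  next
    case False
    have "aeval (rational_transform F u v) x =
        (\<Prod>i<n. aeval v x) * (\<Prod>i<n. aeval u x / aeval v x - z i)"
      using False by (simp add: aeval_rational_transform_nonzero deg) (simp add: assms poly_prod)
    also have "\<dots> = (\<Prod>i<n. aeval u x - z i * aeval v x)"
      unfolding prod.distrib[symmetric] using False by (simp add: algebra_simps)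
    finally show ?thesis .
  qed
qed

text \<open>As \<open>v\<close> has smaller degree than \<open>u\<close>, the top term
  \<open>u ^ n\<close> dominates all the others.\<close>

lemma rational_transform_degree_monic:
  fixes u v F :: "'a::field poly"
  assumes "degree v < degree u" and "lead_coeff u = 1" and "lead_coeff F = 1"
  shows "degree (rational_transform F u v) = degree u * degree F"
    and "lead_coeff (rational_transform F u v) = 1"
proof -
  define n where "n = degree F"
  have u: "u \<noteq> 0" using assms(1) by auto
  define T where "T = (\<Sum>i<n. smult (coeff F i) (u ^ i * v ^ (n - i)))"
  have eq: "rational_transform F u v = T + u ^ n"
    using assms(3) by (simp add: rational_transform_def T_def n_def lessThan_Suc_atMost[symmetric])
  have degu: "degree (u ^ n) = degree u * n" using u by (simp add: degree_power_eq mult.commute)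
  show "degree (rational_transform F u v) = degree u * degree F"
    and "lead_coeff (rational_transform F u v) = 1"
  proof (atomize (full), cases "n = 0")
    case True
    then show "degree (rational_transform F u v) = degree u * degree F \<and>
        lead_coeff (rational_transform F u v) = 1"
      using eq degu by (simp add: T_def n_def)
  next
    case False
    have "degree T < degree u * n"
      unfolding T_def
    proof (rule degree_sum_less)
      fix i assume "i \<in> {..<n}"
      have "degree (smult (coeff F i) (u ^ i * v ^ (n - i))) \<le> degree (u ^ i * v ^ (n - i))"
        by (rule degree_smult_le)
      also have "\<dots> \<le> degree (u ^ i) + degree (v ^ (n - i))" by (rule degree_mult_le)
      also have "\<dots> \<le> degree u * i + degree v * (n - i)"
        by (intro add_mono degree_power_le)
      also have "\<dots> < degree u * i + degree u * (n - i)"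
        using assms(1) \<open>i \<in> {..<n}\<close> by simp
      also have "\<dots> = degree u * n"
        using \<open>i \<in> {..<n}\<close> by (simp flip: distrib_left)
      finally show "degree (smult (coeff F i) (u ^ i * v ^ (n - i))) < degree u * n" .
    qed (use False assms(1) in auto)
    then have "degree T < degree (u ^ n)" by (simp add: degu)
    then have "degree (T + u ^ n) = degree (u ^ n)"
      and "lead_coeff (T + u ^ n) = lead_coeff (u ^ n)"
      by (simp_all add: degree_add_eq_right lead_coeff_add_le coeff_eq_0)
    then show "degree (rational_transform F u v) = degree u * degree F \<and>
        lead_coeff (rational_transform F u v) = 1"
      using lead_coeff_power[of u n] assms(2) degu by (simp only: eq) (simp add: n_def)
  qed
qed


section \<open>Moebius transformations at points\<close>

definition num :: "'a::field ^ 2 ^ 2 \<Rightarrow> 'a alg_closure \<Rightarrow> 'a alg_closure" where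
  "num A x = to_ac (A$1$1) * x + to_ac (A$1$2)"

definition den :: "'a::field ^ 2 ^ 2 \<Rightarrow> 'a alg_closure \<Rightarrow> 'a alg_closure" where
  "den A x = to_ac (A$2$1) * x + to_ac (A$2$2)"

text \<open>
  \<open>(x, 1)\<close> is an eigenvector of \<open>A\<close>; this makes sense without knowing that \<open>den A x \<noteq> 0\<close>.
\<close>

definition fixes_point :: "'a::field ^ 2 ^ 2 \<Rightarrow> 'a alg_closure \<Rightarrow> bool" where
  "fixes_point A x \<longleftrightarrow> num A x = x * den A x"

lemma num_mult: "num (A ** B) x = to_ac (A$1$1) * num B x + to_ac (A$1$2) * den B x"
  and den_mult: "den (A ** B) x = to_ac (A$2$1) * num B x + to_ac (A$2$2) * den B x"
  by (simp_all add: num_def den_def matrix_matrix_mult_def sum_2 algebra_simps)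

lemma num_mat [simp]: "num (mat c) x = to_ac c * x"
  and den_mat [simp]: "den (mat c) x = to_ac c"
  by (simp_all add: num_def den_def mat_def)

lemma num_scale [simp]: "num (mat c ** A) x = to_ac c * num A x"
  and den_scale [simp]: "den (mat c ** A) x = to_ac c * den A x"
  unfolding num_mult den_mult by (simp_all add: mat_def)

lemma det_nonzero:
  fixes A :: "'a::field ^ 2 ^ 2"
  assumes "invertible A"
  shows "A$1$1 * A$2$2 - A$1$2 * A$2$1 \<noteq> 0"
  using assms by (simp add: invertible_det_nz det_2)

lemma num_den_not_both_zero:
  assumes "invertible A" and "den A x = 0"
  shows "num A x \<noteq> 0"
proof
  assume "num A x = 0"
  have "to_ac (A$1$1 * A$2$2 - A$1$2 * A$2$1) = to_ac (A$1$1) * den A x - to_ac (A$2$1) * num A x"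
    by (simp add: num_def den_def algebra_simps)
  then have "A$1$1 * A$2$2 - A$1$2 * A$2$1 = 0"
    using \<open>num A x = 0\<close> assms(2) by (simp del: to_ac_diff to_ac_mult)
  with det_nonzero[OF assms(1)] show False by simp
qed

lemma fixes_point_imp_den_nonzero:
  "invertible A \<Longrightarrow> fixes_point A x \<Longrightarrow> den A x \<noteq> 0"
  using num_den_not_both_zero[of A x] by (auto simp: fixes_point_def)

lemma num_frob_pow: "num A ((frob ^^ k) x) = (frob ^^ k) (num A x)"
  and den_frob_pow: "den A ((frob ^^ k) x) = (frob ^^ k) (den A x)"
  by (simp_all add: num_def den_def)

lemma fixes_point_frob_pow: "fixes_point A x \<Longrightarrow> fixes_point A ((frob ^^ k) x)"
  by (simp add: fixes_point_def num_frob_pow den_frob_pow)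

text \<open>For \<open>A\<close> with rows \<open>(a, b)\<close> and \<open>(c, d)\<close>, the
  fixed points are the roots of \<open>c x^2 + (d - a) x - b\<close>, which is the zero polynomial
  only for a scalar matrix.\<close>

lemma finite_fixed_points:
  fixes A :: "'a::field ^ 2 ^ 2"
  assumes "invertible A" and "A \<notin> scalars2"
  shows "finite {x. fixes_point A x}"
proof -
  have "[:- A$1$2, A$2$2 - A$1$1, A$2$1:] \<noteq> 0"
  proof
    assume "[:- A$1$2, A$2$2 - A$1$1, A$2$1:] = 0"
    then have "A = mat (A$1$1)" by (auto simp: mat_def vec_eq_iff forall_2)
    moreover from this have "A$1$1 \<noteq> 0"
      using det_nonzero[OF assms(1)] \<open>[:- A$1$2, A$2$2 - A$1$1, A$2$1:] = 0\<close> by auto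
    ultimately show False using assms(2) unfolding scalars2_def by blast
  qed
  then have "finite {x. aeval [:- A$1$2, A$2$2 - A$1$1, A$2$1:] x = 0}"
    by (rule finite_aeval_roots)
  also have "{x. aeval [:- A$1$2, A$2$2 - A$1$1, A$2$1:] x = 0} = {x. fixes_point A x}"
    by (auto simp: fixes_point_def num_def den_def algebra_simps)
  finally show ?thesis .
qed

lemma exists_fixed_point:
  fixes A :: "'a::field ^ 2 ^ 2"
  assumes "A$2$1 \<noteq> 0"
  shows "\<exists>x. fixes_point A x"
proof -
  obtain x where "aeval [:- A$1$2, A$2$2 - A$1$1, A$2$1:] x = 0"
    using aeval_root_exists[of "[:- A$1$2, A$2$2 - A$1$1, A$2$1:]"] assms by auto
  then have "fixes_point A x"
    by (simp add: fixes_point_def num_def den_def algebra_simps)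
  then show ?thesis ..
qed

section \<open>Classes in PGL2 as sets of matrices\<close>

lemma PGL2_class_eq:
  assumes "U \<in> carrier PGL2" and "A \<in> U"
  shows "U = {mat c ** A | c. c \<noteq> 0}"
proof -
  obtain B where U: "U = {mat c ** B | c. c \<noteq> 0}" using assms(1) by (auto simp: carrier_PGL2)
  then obtain e where e: "A = mat e ** B" "e \<noteq> 0" using assms(2) by auto
  have "mat c ** B = mat (c / e) ** A" for c
    using e(2) by (simp add: e(1) mat_mul_left)
  moreover have "mat c ** A = mat (c * e) ** B" for c
    by (simp add: e(1) mat_mul_left mult.assoc)
  moreover have "c / e \<noteq> 0" "c * e \<noteq> 0" if "c \<noteq> 0" for c using that e(2) by auto
  ultimately show ?thesis unfolding U by blast
qed

lemma PGL2_class_invertible: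
  assumes "U \<in> carrier PGL2" and "A \<in> U"
  shows "invertible A"
proof -
  obtain B c where A: "A = mat c ** B" "c \<noteq> 0" "invertible B"
    using assms by (auto simp: carrier_PGL2)
  then have "det A = c * c * det B" by (simp add: det_2 mat_mul_left algebra_simps)
  with A show ?thesis by (simp add: invertible_det_nz)
qed

lemma PGL2_class_nonempty:
  fixes U :: "('a::field ^ 2 ^ 2) set"
  assumes "U \<in> carrier PGL2"
  shows "\<exists>A. A \<in> U"
proof -
  obtain B :: "'a ^ 2 ^ 2" where "U = {mat c ** B | c. c \<noteq> 0}"
    using assms by (auto simp: carrier_PGL2)
  then have "mat 1 ** B \<in> U" by (auto intro: exI[of _ 1])
  then show ?thesis ..
qed

lemma PGL2_one: "\<one>\<^bsub>PGL2\<^esub> = scalars2"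
  by (simp add: PGL2_def FactGroup_def)

lemma PGL2_mult_mem: "A \<in> U \<Longrightarrow> B \<in> V \<Longrightarrow> A ** B \<in> U \<otimes>\<^bsub>PGL2\<^esub> V"
  by (auto simp: PGL2_def FactGroup_def set_mult_def GL2_def)

lemma PGL2_class_disjoint:
  assumes "U \<in> carrier PGL2" "V \<in> carrier PGL2" "A \<in> U" "A \<in> V"
  shows "U = V"
  using PGL2_class_eq[OF assms(1,3)] PGL2_class_eq[OF assms(2,4)] by (rule trans[OF _ sym])


section \<open>Quotient maps of groups of prime order\<close>

text \<open>The first assumption says that the vectors \<open>(a, b)\<close> and
  \<open>(c, d)\<close> are proportional, the second that a matrix with rows \<open>(u, v)\<close>
  and \<open>(w, z)\<close> sends \<open>(a, b)\<close> to a multiple of \<open>(x, 1)\<close>. The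
  same then follows for \<open>(c, d)\<close>, up to a factor \<open>a\<close> or \<open>b\<close>
  that can be cancelled if nonzero.\<close>

lemma eigenvector_transfer:
  fixes a :: "'a::field"
  assumes "a * d = c * b" and "u * a + v * b = x * (w * a + z * b)"
  shows "b * (u * c + v * d) = b * (x * (w * c + z * d))"
    and "a * (u * c + v * d) = a * (x * (w * c + z * d))"
proof -
  have "b * (u * c + v * d) = u * (c * b) + v * (b * d)" by (simp add: algebra_simps)
  also have "\<dots> = d * (u * a + v * b)"
    unfolding assms(1)[symmetric] by (simp add: algebra_simps)
  also have "\<dots> = x * (w * (a * d) + z * (b * d))"
    unfolding assms(2) by (simp add: algebra_simps)
  also have "\<dots> = b * (x * (w * c + z * d))"
    unfolding assms(1) by (simp add: algebra_simps)
  finally show "b * (u * c + v * d) = b * (x * (w * c + z * d))" .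
  have "a * (u * c + v * d) = u * (a * c) + v * (a * d)" by (simp add: algebra_simps)
  also have "\<dots> = c * (u * a + v * b)"
    unfolding assms(1) by (simp add: algebra_simps)
  also have "\<dots> = x * (w * (a * c) + z * (c * b))"
    unfolding assms(2) by (simp add: algebra_simps)
  also have "\<dots> = a * (x * (w * c + z * d))"
    unfolding assms(1)[symmetric] by (simp add: algebra_simps)
  finally show "a * (u * c + v * d) = a * (x * (w * c + z * d))" .
qed

locale prime_quotient_map =
  fixes G :: "('a::{field, finite} ^ 2 ^ 2) set set" and g h :: "'a poly" and s :: nat
  assumes subgroup_G: "subgroup G PGL2"
    and card_G: "card G = s"
    and prime_s: "prime s"
    and quotient: "quotient_map G g h"
begin

lemma h_nonzero: "h \<noteq> 0"
  and coprime_gh: "coprime g h"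
  and degree_g: "degree g = s"
  and coeff_g [simp]: "coeff g s = 1"
  and degree_h: "degree h < s"
  using quotient card_G unfolding quotient_map_def by (elim conjE, simp)+

lemma coeff_h [simp]: "coeff h s = 0"
  using degree_h by (simp add: coeff_eq_0)

lemma finite_G [simp]: "finite G"
  by (rule finite)

lemma G_carrier: "U \<in> G \<Longrightarrow> U \<in> carrier PGL2"
  using subgroup.subset[OF subgroup_G] by auto

lemma G_invertible: "A \<in> \<Union>G \<Longrightarrow> invertible A"
  by (auto intro: PGL2_class_invertible G_carrier)

lemma G_inverse:
  assumes "U \<in> G" and "A \<in> U"
  obtains C c where "C \<in> inv\<^bsub>PGL2\<^esub> U" and "C ** A = mat c" and "c \<noteq> 0"
proof -
  interpret group PGL2 by (rule group_PGL2)
  obtain C where C: "C \<in> inv\<^bsub>PGL2\<^esub> U" using PGL2_class_nonempty G_carrier assms(1) by blast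
  have "C ** A \<in> inv\<^bsub>PGL2\<^esub> U \<otimes>\<^bsub>PGL2\<^esub> U" by (rule PGL2_mult_mem) fact+
  then have "C ** A \<in> scalars2" using G_carrier[OF assms(1)] by (simp add: PGL2_one)
  with C that show thesis by (auto simp: scalars2_def)
qed

lemma gh_not_both_zero:
  assumes "aeval h x = 0"
  shows "aeval g x \<noteq> 0"
proof
  assume "aeval g x = 0"
  then have "minpoly x dvd g" "minpoly x dvd h" using assms by (auto intro: minpoly_dvd)
  then have "is_unit (minpoly x)" using coprime_gh by (auto dest: coprime_common_divisor)
  then show False using irreducible_minpoly irreducible_not_unit by blast
qed

text \<open>\<open>Q (A x) = Q x\<close> holds as an identity of rational functions; clearing
  denominators makes it a polynomial identity that can be evaluated at \<open>x\<close>.\<close>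

lemma invariance:
  assumes "A \<in> \<Union>G" and "aeval h x \<noteq> 0"
  shows "den A x \<noteq> 0"
    and "aeval g (num A x / den A x) * aeval h x = aeval h (num A x / den A x) * aeval g x"
proof -
  define u v where "u = [:A$1$2, A$1$1:]" and "v = [:A$2$2, A$2$1:]"
  have inv: "invertible A" using assms(1) by (rule G_invertible)
  have v: "v \<noteq> 0" using det_nonzero[OF inv] by (auto simp: v_def)
  have ev: "aeval u y = num A y" "aeval v y = den A y" for y
    by (simp_all add: u_def v_def num_def den_def algebra_simps)
  define R where "R = moebius_ratfun A"
  have R: "R = Fract u v" by (simp add: R_def moebius_ratfun_def u_def v_def)
  have nz: "eval_ratfun r R \<noteq> 0" if "r \<noteq> 0" for r
    unfolding R_def using inv that by (rule eval_ratfun_moebius_ratfun_nonzero)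
  \<comment> \<open>The generator is the value of the polynomial \<open>[:0, 1:]\<close> at
    itself.\<close>
  have "Fract g h \<in> adjoin_ratfun (Fract g h)"
    unfolding adjoin_ratfun_def
    by (rule CollectI, intro exI[of _ "[:0, 1:]"] exI[of _ 1]) (simp add: one_pCons)
  then have "Fract g h \<in> invariant_ratfuns G" using quotient by (simp add: quotient_map_def)
  then have "ratfun_compose (Fract g h) R = Fract g h"
    using assms(1) unfolding R_def invariant_ratfuns_def by blast
  then have "eval_ratfun g R / eval_ratfun h R = to_fract g / to_fract h"
    using ratfun_compose_Fract[OF nz h_nonzero] by (simp add: Fract_conv_to_fract)
  then have cross: "eval_ratfun g R * to_fract h = to_fract g * eval_ratfun h R"
    using nz[OF h_nonzero] h_nonzero by (simp add: frac_eq_eq)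
  have pow: "to_fract (p ^ i) = to_fract p ^ i" for p :: "'a poly" and i
    by (induction i) simp_all
  \<comment> \<open>The transforms of \<open>g\<close> and \<open>h\<close> clear the powers
    \<open>v ^ s\<close> and \<open>v ^ degree h\<close>, so \<open>k\<close> factors
    \<open>v\<close> are left over. As \<open>k > 0\<close>, one side vanishes where
    \<open>den A x = 0\<close>, which rules this out when \<open>h\<close> is nonzero at
    \<open>x\<close>.\<close>
  define k where "k = s - degree h"
  have k: "s = k + degree h" "k > 0" using degree_h by (auto simp: k_def)
  have "to_fract (rational_transform g u v * h * v ^ degree h) =
      to_fract v ^ s * to_fract v ^ degree h * (eval_ratfun g R * to_fract h)"
    using v by (simp add: rational_transform_eq R degree_g pow)
  also have "\<dots> = to_fract (rational_transform h u v * g * v ^ s)"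
    unfolding cross using v by (simp add: rational_transform_eq R pow)
  finally have "rational_transform g u v * h * v ^ degree h = rational_transform h u v * g * v ^ s"
    by (simp only: to_fract_eq_iff)
  then have "(rational_transform g u v * h) * v ^ degree h =
      (rational_transform h u v * g * v ^ k) * v ^ degree h"
    by (simp add: k(1) power_add mult.assoc)
  then have "rational_transform g u v * h = rational_transform h u v * g * v ^ k"
    using v by simp
  from arg_cong[OF this, of "\<lambda>p. aeval p x"]
  have eq: "aeval (rational_transform g u v) x * aeval h x =
      aeval (rational_transform h u v) x * aeval g x * den A x ^ k"
    by (simp add: ev)
  show den: "den A x \<noteq> 0"
  proof
    assume "den A x = 0"
    then have "num A x ^ s * aeval h x = 0"
      using eq k(2) by (simp add: aeval_rational_transform_zero ev degree_g power_0_left)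
    with assms(2) num_den_not_both_zero[OF inv \<open>den A x = 0\<close>] show False by simp
  qed
  have "den A x ^ s * (aeval g (num A x / den A x) * aeval h x) =
      den A x ^ s * (aeval h (num A x / den A x) * aeval g x)"
    using eq den by (simp add: aeval_rational_transform_nonzero ev degree_g k(1) power_add)
  then show "aeval g (num A x / den A x) * aeval h x = aeval h (num A x / den A x) * aeval g x"
    using den by simp
qed

text \<open>The stabilizer of \<open>x\<close> is a subgroup of \<open>G\<close> that contains the
  nontrivial class of \<open>D\<close>; by Lagrange it is all of \<open>G\<close>, whose order is
  prime.\<close>

lemma fixes_point_all:
  assumes "D \<in> \<Union>G" and "D \<notin> scalars2" and "fixes_point D x" and "B \<in> \<Union>G"
  shows "fixes_point B x"
proof -
  interpret PGL: group "PGL2 :: ('a ^ 2 ^ 2) set monoid" by (rule group_PGL2)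
  define H where "H = {U \<in> G. \<forall>A\<in>U. fixes_point A x}"
  have H: "U \<in> H" if "U \<in> G" "A \<in> U" "fixes_point A x" for U A
    using that PGL2_class_eq[OF G_carrier, OF that(1,2)] by (auto simp: H_def fixes_point_def)
  have one: "\<one>\<^bsub>PGL2\<^esub> \<in> H"
    using subgroup.one_closed[OF subgroup_G]
    by (intro H[of _ "mat 1"]) (auto simp: PGL2_one scalars2_def fixes_point_def intro!: exI[of _ 1])
  have "subgroup H PGL2"
  proof (rule PGL.subgroupI)
    show "H \<subseteq> carrier PGL2" using G_carrier by (auto simp: H_def)
    show "H \<noteq> {}" using one by auto
  next
    fix U assume "U \<in> H"
    then have U: "U \<in> G" by (simp add: H_def)
    obtain A where A: "A \<in> U" using PGL2_class_nonempty G_carrier[OF U] by blast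
    then have fixed: "num A x = x * den A x" using \<open>U \<in> H\<close> by (auto simp: H_def fixes_point_def)
    then have "den A x \<noteq> 0"
      using A U G_invertible[of A] fixes_point_imp_den_nonzero by (auto simp: fixes_point_def)
    obtain C c where C: "C \<in> inv\<^bsub>PGL2\<^esub> U" "C ** A = mat c" by (rule G_inverse[OF U A])
    have "num (C ** A) x = x * den (C ** A) x" by (simp add: C(2))
    moreover have "num (C ** A) x = den A x * num C x" "den (C ** A) x = den A x * den C x"
      unfolding num_mult den_mult fixed by (simp_all add: num_def den_def algebra_simps)
    ultimately have "den A x * num C x = den A x * (x * den C x)" by simp
    then have "fixes_point C x" using \<open>den A x \<noteq> 0\<close> by (simp add: fixes_point_def)
    then show "inv\<^bsub>PGL2\<^esub> U \<in> H" using C(1) subgroup.m_inv_closed[OF subgroup_G U] H by blast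
  next
    fix U V assume XY: "U \<in> H" "V \<in> H"
    then have "U \<in> G" "V \<in> G" by (auto simp: H_def)
    obtain A where A: "A \<in> U" using PGL2_class_nonempty[OF G_carrier[OF \<open>U \<in> G\<close>]] by blast
    obtain C where C: "C \<in> V" using PGL2_class_nonempty[OF G_carrier[OF \<open>V \<in> G\<close>]] by blast
    from A C have "num A x = x * den A x" "num C x = x * den C x"
      using XY by (auto simp: H_def fixes_point_def)
    moreover have "num (A ** C) x = den C x * num A x" "den (A ** C) x = den C x * den A x"
      unfolding num_mult den_mult \<open>num C x = x * den C x\<close>
      by (simp_all add: num_def den_def algebra_simps)
    ultimately have "fixes_point (A ** C) x" by (simp add: fixes_point_def)
    then show "U \<otimes>\<^bsub>PGL2\<^esub> V \<in> H"
      using subgroup.m_closed[OF subgroup_G \<open>U \<in> G\<close> \<open>V \<in> G\<close>] PGL2_mult_mem[OF A C] H by blast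
  qed
  then have "subgroup H (PGL2\<lparr>carrier := G\<rparr>)"
    by (rule PGL.subgroup_incl[OF _ subgroup_G]) (auto simp: H_def)
  then have "card (rcosets\<^bsub>PGL2\<lparr>carrier := G\<rparr>\<^esub> H) * card H = card G"
    using group.lagrange_finite[OF subgroup.subgroup_is_group[OF subgroup_G group_PGL2], of H]
    by (simp add: Coset.order_def)
  then have "card H dvd card G" by (metis dvd_triv_right)
  then have "card H = 1 \<or> card H = s" using prime_s by (simp add: card_G prime_nat_iff)
  moreover obtain U where U: "U \<in> G" "D \<in> U" using assms(1) by blast
  then have "U \<in> H" using assms(3) H by blast
  then have "card H \<noteq> 1"
    using one U(2) assms(2) by (auto simp: PGL2_one card_1_singleton_iff)
  moreover have "H \<subseteq> G" by (auto simp: H_def)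
  ultimately have "H = G" using card_subset_eq[of G H] by (simp add: card_G)
  with assms(4) show ?thesis by (auto simp: H_def)
qed

text \<open>If two classes send \<open>x\<close> to the same point, the inverse of one times the
  other fixes \<open>x\<close>. Cross multiplication covers points sent to infinity as well.\<close>

lemma collision_imp_fixed:
  assumes "U \<in> G" "V \<in> G" "U \<noteq> V" "A \<in> U" "B \<in> V"
    and eq: "num A x * den B x = num B x * den A x"
  shows "\<exists>D\<in>\<Union>G - scalars2. fixes_point D x"
proof -
  interpret PGL: group "PGL2 :: ('a ^ 2 ^ 2) set monoid" by (rule group_PGL2)
  obtain C c where C: "C \<in> inv\<^bsub>PGL2\<^esub> U" "C ** A = mat c" by (rule G_inverse[OF assms(1,4)])
  define Z where "Z = inv\<^bsub>PGL2\<^esub> U \<otimes>\<^bsub>PGL2\<^esub> V"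
  have Z: "Z \<in> G"
    unfolding Z_def using assms(1,2) subgroup_G by (simp add: subgroup.m_closed subgroup.m_inv_closed)
  have mem: "C ** B \<in> Z" unfolding Z_def using C(1) assms(5) by (rule PGL2_mult_mem)
  have "Z \<noteq> \<one>\<^bsub>PGL2\<^esub>"
    using assms(1-3) G_carrier PGL.inv_equality[of "inv\<^bsub>PGL2\<^esub> U" V] unfolding Z_def by auto
  then have "C ** B \<notin> scalars2"
    using PGL2_class_disjoint[OF G_carrier[OF Z] PGL.one_closed mem] by (auto simp: PGL2_one)
  moreover have "fixes_point (C ** B) x"
  proof -
    have CA: "num (C ** A) x = x * den (C ** A) x" by (simp add: C(2))
    \<comment> \<open>The proportional vectors are \<open>(num A x, den A x)\<close> and
      \<open>(num B x, den B x)\<close>, and the matrix is \<open>C\<close>. One entry of the first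
      vector is nonzero, so a factor can be cancelled.\<close>
    note * = eigenvector_transfer[OF eq CA[unfolded num_mult den_mult], folded num_mult den_mult]
    show ?thesis
      using * num_den_not_both_zero[of A x] G_invertible[of A] assms(1,4)
      by (auto simp: fixes_point_def)
  qed
  ultimately show ?thesis using Z mem by blast
qed

section \<open>The action of \<open>G\<close> on points and the fibre identity\<close>

definition rep :: "('a ^ 2 ^ 2) set \<Rightarrow> 'a ^ 2 ^ 2" where
  "rep U = (SOME A. A \<in> U)"

lemma rep_mem: "U \<in> G \<Longrightarrow> rep U \<in> U"
  unfolding rep_def by (rule someI_ex, rule PGL2_class_nonempty, rule G_carrier)

lemma rep_mem_Union: "U \<in> G \<Longrightarrow> rep U \<in> \<Union>G"
  by (rule UnionI[OF _ rep_mem])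

text \<open>For \<open>U\<close> in \<open>G\<close> the choice made by \<open>rep\<close> is
  immaterial, since a scalar factor cancels in the quotient.\<close>

definition act :: "('a ^ 2 ^ 2) set \<Rightarrow> 'a alg_closure \<Rightarrow> 'a alg_closure" where
  "act U x = num (rep U) x / den (rep U) x"

lemma not_inj_imp_fixed:
  assumes "aeval h x \<noteq> 0" and "\<not> inj_on (\<lambda>U. act U x) G"
  shows "\<exists>D\<in>\<Union>G - scalars2. fixes_point D x"
proof -
  obtain U V where XY: "U \<in> G" "V \<in> G" "U \<noteq> V" "act U x = act V x"
    using assms(2) by (auto simp: inj_on_def)
  moreover from XY have "den (rep U) x \<noteq> 0" "den (rep V) x \<noteq> 0"
    using invariance(1)[OF _ assms(1)] rep_mem_Union by blast+
  ultimately have "num (rep U) x * den (rep V) x = num (rep V) x * den (rep U) x"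
    by (simp add: act_def frac_eq_eq)
  with XY show ?thesis using collision_imp_fixed rep_mem by blast
qed

lemma finite_fixed: "finite {x. \<exists>D\<in>\<Union>G - scalars2. fixes_point D x}"
proof -
  have "{x. \<exists>D\<in>\<Union>G - scalars2. fixes_point D x} = (\<Union>D\<in>\<Union>G - scalars2. {x. fixes_point D x})"
    by auto
  also have "finite \<dots>"
    using finite_fixed_points G_invertible by (intro finite_UN_I) auto
  finally show ?thesis .
qed

lemma aeval_g_act: "U \<in> G \<Longrightarrow> aeval h x \<noteq> 0 \<Longrightarrow>
    aeval g (act U x) * aeval h x = aeval h (act U x) * aeval g x"
  unfolding act_def by (rule invariance(2)[OF rep_mem_Union])

text \<open>As polynomials in \<open>t\<close>, both sides have degree at most \<open>s\<close> and
  the same coefficient at \<open>s\<close>, and they agree at the \<open>s\<close> distinct points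
  \<open>act U x\<close>.\<close>

lemma fibre_identity_generic:
  assumes "aeval h x \<noteq> 0" and inj: "inj_on (\<lambda>U. act U x) G"
  shows "aeval g t * aeval h x - aeval g x * aeval h t = aeval h x * (\<Prod>U\<in>G. t - act U x)"
proof -
  define p where "p = smult (aeval h x) (lift_ac g) - smult (aeval g x) (lift_ac h)"
  define q where "q = (\<Prod>U\<in>G. [:- act U x, 1:])"
  have q: "degree q = s" "coeff q s = 1"
    using lead_coeff_prod[of "\<lambda>U. [:- act U x, 1:]" G]
    by (simp_all add: q_def degree_prod_eq_sum_degree card_G)
  have "p = smult (aeval h x) q"
  proof (rule poly_eqI_degree_lead_coeff[of _ s _ "(\<lambda>U. act U x) ` G"])
    show "coeff p s = coeff (smult (aeval h x) q) s" by (simp add: p_def q)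
    show "s \<le> card ((\<lambda>U. act U x) ` G)" using inj by (simp add: card_image card_G)
    show "degree p \<le> s"
      unfolding p_def using degree_g degree_h
      by (intro degree_diff_le order.trans[OF degree_smult_le]) auto
    show "degree (smult (aeval h x) q) \<le> s" using q degree_smult_le[of "aeval h x" q] by simp
    fix z assume "z \<in> (\<lambda>U. act U x) ` G"
    then show "poly p z = poly (smult (aeval h x) q) z"
      using aeval_g_act[OF _ assms(1)] by (auto simp: p_def q_def poly_prod mult.commute)
  qed
  then have "poly p t = poly (smult (aeval h x) q) t" by simp
  then show ?thesis by (simp add: p_def q_def poly_prod mult.commute)
qed

text \<open>
  Both sides are polynomials in \<open>x\<close> that agree wherever the \<open>G\<close>-orbit of \<open>x\<close> has \<open>s\<close> elements.
\<close>

lemma fibre_identity: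
  "(aeval g t * aeval h x - aeval g x * aeval h t) * (\<Prod>U\<in>G. den (rep U) x) =
     aeval h x * (\<Prod>U\<in>G. t * den (rep U) x - num (rep U) x)"
proof -
  define p where "p = (smult (aeval g t) (lift_ac h) - smult (aeval h t) (lift_ac g)) *
      (\<Prod>U\<in>G. lift_ac [:rep U $2$2, rep U $2$1:])"
  define q where "q = lift_ac h *
      (\<Prod>U\<in>G. smult t (lift_ac [:rep U $2$2, rep U $2$1:]) - lift_ac [:rep U $1$2, rep U $1$1:])"
  have p: "poly p x =
      (aeval g t * aeval h x - aeval g x * aeval h t) * (\<Prod>U\<in>G. den (rep U) x)" for x
    by (simp add: p_def poly_prod den_def algebra_simps)
  have q: "poly q x = aeval h x * (\<Prod>U\<in>G. t * den (rep U) x - num (rep U) x)" for x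
    by (simp add: q_def poly_prod den_def num_def algebra_simps)
  have "p = q"
  proof (rule poly_eq_if_cofinitely_eq)
    show "finite ({x. aeval h x = 0} \<union> {x. \<exists>D\<in>\<Union>G - scalars2. fixes_point D x})"
      using finite_fixed finite_aeval_roots[OF h_nonzero] by simp
    fix x assume "x \<notin> {x. aeval h x = 0} \<union> {x. \<exists>D\<in>\<Union>G - scalars2. fixes_point D x}"
    then have hx: "aeval h x \<noteq> 0" and inj: "inj_on (\<lambda>U. act U x) G"
      using not_inj_imp_fixed[of x] by auto
    have "(\<Prod>U\<in>G. t * den (rep U) x - num (rep U) x) =
        (\<Prod>U\<in>G. (t - act U x) * den (rep U) x)"
      using invariance(1)[OF rep_mem_Union hx]
      by (intro prod.cong) (auto simp: act_def algebra_simps)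
    then show "poly p x = poly q x"
      unfolding p q fibre_identity_generic[OF hx inj] by (simp add: prod.distrib)
  qed
  then show ?thesis using p q by metis
qed

text \<open>Away from the poles no denominator in \<open>fibre_identity\<close> vanishes, so they
  can be divided out. This extends the generic formula to points with repeated images under
  \<open>G\<close>.\<close>

lemma fibre_product:
  assumes "aeval h x \<noteq> 0"
  shows "aeval g t * aeval h x - aeval g x * aeval h t = aeval h x * (\<Prod>U\<in>G. t - act U x)"
proof -
  have den: "den (rep U) x \<noteq> 0" if "U \<in> G" for U
    using invariance(1)[OF rep_mem_Union[OF that] assms] .
  have "(\<Prod>U\<in>G. t * den (rep U) x - num (rep U) x) =
      (\<Prod>U\<in>G. t - act U x) * (\<Prod>U\<in>G. den (rep U) x)"
    unfolding prod.distrib[symmetric]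
    by (intro prod.cong) (auto simp: act_def den algebra_simps)
  moreover have "(\<Prod>U\<in>G. den (rep U) x) \<noteq> 0" using den by simp
  ultimately show ?thesis using fibre_identity[of t x] by (simp add: mult.assoc[symmetric])
qed

text \<open>At a pole the right side of \<open>fibre_identity\<close> is zero, while
  \<open>aeval g x * aeval h t\<close> is nonzero for a suitable \<open>t\<close>; so the product of
  the denominators vanishes.\<close>

lemma pole_imp_den_zero:
  assumes "aeval h x = 0"
  shows "\<exists>A\<in>\<Union>G. den A x = 0"
proof -
  have "{t. aeval h t = 0} \<noteq> UNIV"
    using finite_aeval_roots[OF h_nonzero] infinite_UNIV_alg_closed by metis
  then obtain t where "aeval h t \<noteq> 0" by auto
  then have "(\<Prod>U\<in>G. den (rep U) x) = 0"
    using fibre_identity[of t x] assms gh_not_both_zero[OF assms] by simp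
  then obtain U where "U \<in> G" "den (rep U) x = 0" by auto
  then show ?thesis using rep_mem_Union by blast
qed


subsection \<open>Fibres\<close>

text \<open>Clearing the denominator admits no poles, because \<open>g\<close> and \<open>h\<close>
  have no common root.\<close>

definition fibre :: "'a alg_closure \<Rightarrow> 'a alg_closure set" where
  "fibre y = {t. aeval g t = y * aeval h t}"

lemma fibre_h_nonzero:
  assumes "x \<in> fibre y"
  shows "aeval h x \<noteq> 0"
proof
  assume "aeval h x = 0"
  then show False using gh_not_both_zero[of x] assms by (simp add: fibre_def)
qed

lemma mem_fibre_iff: "x \<in> fibre y \<longleftrightarrow> aeval h x \<noteq> 0 \<and> y = aeval g x / aeval h x"
proof (cases "aeval h x = 0")
  case True
  then show ?thesis by (simp add: fibre_def gh_not_both_zero)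
next
  case False
  then show ?thesis by (auto simp: fibre_def nonzero_eq_divide_eq)
qed

lemma fibre_nonempty: "fibre y \<noteq> {}"
proof -
  have "coeff (lift_ac g - smult y (lift_ac h)) s \<noteq> 0" by simp
  then have "degree (lift_ac g - smult y (lift_ac h)) \<ge> s" by (rule le_degree)
  then have "degree (lift_ac g - smult y (lift_ac h)) > 0"
    using prime_gt_0_nat[OF prime_s] by simp
  then obtain t where "poly (lift_ac g - smult y (lift_ac h)) t = 0"
    using alg_closed_imp_poly_has_root by blast
  then show ?thesis by (auto simp: fibre_def)
qed

lemma fibre_eq_orbit:
  assumes "x \<in> fibre y"
  shows "fibre y = (\<lambda>U. act U x) ` G"
proof -
  have hx: "aeval h x \<noteq> 0" and y: "y = aeval g x / aeval h x"
    using assms by (auto simp: mem_fibre_iff)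
  have "t \<in> fibre y \<longleftrightarrow> aeval g t * aeval h x - aeval g x * aeval h t = 0" for t
    unfolding fibre_def y using hx by (simp add: field_simps)
  then have "t \<in> fibre y \<longleftrightarrow> (\<Prod>U\<in>G. t - act U x) = 0" for t
    unfolding fibre_product[OF hx] using hx by simp
  then show ?thesis by auto
qed

lemma act_eq_if_fixed:
  assumes "U \<in> G" and "fixes_point (rep U) x"
  shows "act U x = x"
  using assms fixes_point_imp_den_nonzero[OF G_invertible[OF rep_mem_Union]]
  by (simp add: act_def fixes_point_def)

text \<open>Either the \<open>s\<close> images of a point are distinct, or a collision yields a
  nontrivial element fixing it; then all of \<open>G\<close> fixes it and its orbit is a single
  point.\<close>

lemma fibre_cases:
  obtains "card (fibre y) = s"
  | x where "fibre y = {x}" and "\<And>A. A \<in> \<Union>G \<Longrightarrow> fixes_point A x"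
proof -
  obtain x where x: "x \<in> fibre y" using fibre_nonempty by blast
  show thesis
  proof (cases "inj_on (\<lambda>U. act U x) G")
    case True
    then show thesis using that(1) fibre_eq_orbit[OF x] by (simp add: card_image card_G)
  next
    case False
    then have fixed: "fixes_point A x" if "A \<in> \<Union>G" for A
      using not_inj_imp_fixed[OF fibre_h_nonzero[OF x]] fixes_point_all that by blast
    then have "act U x = x" if "U \<in> G" for U
      using act_eq_if_fixed rep_mem_Union that by blast
    then have "fibre y = {x}" using fibre_eq_orbit[OF x] x by auto
    then show thesis using that(2) fixed by blast
  qed
qed

lemma fixed_imp_pole_free:
  assumes "\<And>A. A \<in> \<Union>G \<Longrightarrow> fixes_point A x"
  shows "aeval h x \<noteq> 0"
  using pole_imp_den_zero[of x] fixes_point_imp_den_nonzero G_invertible assms by blast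

lemma fixed_imp_fibre:
  assumes "\<And>A. A \<in> \<Union>G \<Longrightarrow> fixes_point A x"
  shows "fibre (aeval g x / aeval h x) = {x}"
proof -
  have mem: "x \<in> fibre (aeval g x / aeval h x)"
    using fixed_imp_pole_free[OF assms] by (simp add: mem_fibre_iff)
  have "act U x = x" if "U \<in> G" for U
    using act_eq_if_fixed rep_mem_Union that assms by blast
  then have "(\<lambda>U. act U x) ` G \<subseteq> {x}" by auto
  then show ?thesis using mem fibre_eq_orbit[OF mem] by auto
qed

lemma finite_fibre [simp]: "finite (fibre y)"
proof -
  obtain x where "x \<in> fibre y" using fibre_nonempty by blast
  then have "fibre y = (\<lambda>U. act U x) ` G" by (rule fibre_eq_orbit)
  then show ?thesis by simp
qed

lemma fibre_disjoint: "y \<noteq> z \<Longrightarrow> fibre y \<inter> fibre z = {}"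
  by (auto simp: mem_fibre_iff)

lemma frob_pow_mem_fibre_iff: "(frob ^^ k) x \<in> fibre ((frob ^^ k) y) \<longleftrightarrow> x \<in> fibre y"
  by (simp add: fibre_def aeval_frob_pow flip: frob_pow_mult)

lemma frob_pow_image_fibre: "(frob ^^ k) ` fibre y \<subseteq> fibre ((frob ^^ k) y)"
  by (auto simp: frob_pow_mem_fibre_iff)

lemma period_fibre_dvd:
  assumes "x \<in> fibre y"
  shows "period y dvd period x"
proof -
  have "(frob ^^ period x) y = y"
    using assms by (simp add: mem_fibre_iff flip: aeval_frob_pow)
  then show ?thesis by (simp add: frob_pow_fixed_iff)
qed

text \<open>The points of a fibre differ by matrices over the base field, so a Frobenius power that
  fixes one of them fixes all.\<close>

lemma period_fibre_eq:
  assumes "x \<in> fibre y" and "t \<in> fibre y"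
  shows "period x = period t"
proof -
  have "period t dvd period x" if "x \<in> fibre y" "t \<in> fibre y" for x t
  proof -
    have "t \<in> (\<lambda>U. act U x) ` G" using that fibre_eq_orbit[OF that(1)] by simp
    then obtain U where "t = act U x" by blast
    then have "(frob ^^ period x) t = t"
      by (simp add: act_def flip: num_frob_pow den_frob_pow)
    then show ?thesis by (simp add: frob_pow_fixed_iff)
  qed
  with assms show ?thesis by (simp add: dvd_antisym)
qed


subsection \<open>Factorization of the transform of an irreducible polynomial\<close>

abbreviation transform :: "'a poly \<Rightarrow> 'a poly" where
  "transform f \<equiv> rational_transform f g h"

lemma s_gt_1: "s > 1"
  using prime_s by (rule prime_gt_1_nat)

lemma degree_transform: "degree (transform (minpoly y)) = s * period y"
  and lead_coeff_transform: "lead_coeff (transform (minpoly y)) = 1"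
  using rational_transform_degree_monic[of h g "minpoly y"] by (simp_all add: degree_g degree_h)

lemma transform_nonzero: "transform (minpoly y) \<noteq> 0"
  using lead_coeff_transform[of y] by auto

lemma aeval_transform:
  "aeval (transform (minpoly y)) t = (\<Prod>i<period y. aeval g t - (frob ^^ i) y * aeval h t)"
  by (rule aeval_rational_transform_split[OF lift_ac_minpoly])

lemma aeval_transform_eq_0_iff:
  "aeval (transform (minpoly y)) t = 0 \<longleftrightarrow> t \<in> (\<Union>i<period y. fibre ((frob ^^ i) y))"
  by (auto simp: aeval_transform fibre_def)

lemma aeval_transform_fibre:
  assumes "x \<in> fibre y"
  shows "aeval (transform (minpoly y)) x = 0"
  unfolding aeval_transform_eq_0_iff using assms by (intro UN_I[of 0]) simp_all

lemma card_fibre_le: "card (fibre y) \<le> s"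
proof -
  obtain x where "x \<in> fibre y" using fibre_nonempty by blast
  then have "fibre y = (\<lambda>U. act U x) ` G" by (rule fibre_eq_orbit)
  then show ?thesis using card_image_le[OF finite_G] by (simp add: card_G)
qed

lemma card_fibre_frob_pow:
  assumes "card (fibre y) = s"
  shows "card (fibre ((frob ^^ i) y)) = s"
proof (rule antisym[OF card_fibre_le])
  have "s = card ((frob ^^ i) ` fibre y)"
    using assms by (subst card_image) (auto intro: inj_onI)
  also have "\<dots> \<le> card (fibre ((frob ^^ i) y))"
    by (rule card_mono[OF finite_fibre frob_pow_image_fibre])
  finally show "s \<le> card (fibre ((frob ^^ i) y))" .
qed

text \<open>The roots are the disjoint union of the fibres over the conjugates of \<open>y\<close>,
  and each of these fibres has \<open>s\<close> points.\<close>

lemma card_roots_transform: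
  assumes "card (fibre y) = s"
  shows "card {t. aeval (transform (minpoly y)) t = 0} = s * period y"
proof -
  have "{t. aeval (transform (minpoly y)) t = 0} = (\<Union>i\<in>{..<period y}. fibre ((frob ^^ i) y))"
    using aeval_transform_eq_0_iff by blast
  also have "card \<dots> = (\<Sum>i\<in>{..<period y}. card (fibre ((frob ^^ i) y)))"
  proof (rule card_UN_disjoint)
    show "\<forall>i\<in>{..<period y}. \<forall>j\<in>{..<period y}. i \<noteq> j \<longrightarrow>
        fibre ((frob ^^ i) y) \<inter> fibre ((frob ^^ j) y) = {}"
      using inj_on_frob_orbit[of y] by (auto simp: inj_on_def intro!: fibre_disjoint)
  qed auto
  also have "\<dots> = s * period y"
    using card_fibre_frob_pow[OF assms] by (simp add: mult.commute)
  finally show ?thesis .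
qed

lemma period_root_transform:
  assumes "x \<in> fibre y" and "aeval (transform (minpoly y)) t = 0"
  shows "period t = period x"
proof -
  obtain i where "t \<in> fibre ((frob ^^ i) y)"
    using assms(2) unfolding aeval_transform_eq_0_iff by blast
  moreover have "(frob ^^ i) x \<in> fibre ((frob ^^ i) y)"
    using assms(1) by (simp add: frob_pow_mem_fibre_iff)
  ultimately have "period t = period ((frob ^^ i) x)" by (rule period_fibre_eq)
  then show ?thesis by simp
qed

text \<open>
  All irreducible factors of the transform have degree \<open>period x\<close>, so counting its \<open>s * period y\<close>
  distinct roots gives \<open>period x dvd s * period y\<close>.
\<close>

lemma period_unramified_fibre:
  assumes "card (fibre y) = s" and x: "x \<in> fibre y"
  shows "period x = period y \<or> period x = s * period y"
proof -
  define W where "W = {t. aeval (transform (minpoly y)) t = 0}"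
  have fin: "finite W" unfolding W_def by (rule finite_aeval_roots[OF transform_nonzero])
  have sub: "minpoly ` W \<subseteq> monic_irreducibles_deg (period x)"
    using period_root_transform[OF x] by (auto simp: W_def minpoly_monic_irreducible_deg)
  \<comment> \<open>\<open>W\<close> is the root set of a polynomial over the base field, hence a
    union of Frobenius orbits.\<close>
  have "minpoly -` (minpoly ` W) = W"
    by (auto simp: minpoly_eq_iff W_def aeval_frob_pow)
  then have "card W = period x * card (minpoly ` W)"
    using card_minpoly_vimage(2)[OF sub] fin by simp
  then have "period x dvd s * period y"
    using card_roots_transform[OF assms(1)] by (simp add: W_def)
  moreover obtain j where j: "period x = period y * j"
    using period_fibre_dvd[OF x] by (rule dvdE)
  ultimately have "period y * j dvd period y * s" by (simp add: mult.commute)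
  then have "j dvd s" by (rule dvd_mult_cancel[OF _ period_pos])
  then have "j = 1 \<or> j = s" using prime_s by (simp add: prime_nat_iff)
  with j show ?thesis by (auto simp: mult.commute)
qed

text \<open>\<open>minpoly x\<close> divides the monic transform of \<open>minpoly y\<close>, so the
  transform is irreducible exactly when both have the same degree.\<close>

lemma minpoly_mem_C_set_iff:
  assumes "x \<in> fibre y"
  shows "minpoly y \<in> C_set G g h n \<longleftrightarrow> period y = n \<and> period x = s * n"
proof
  assume C: "minpoly y \<in> C_set G g h n"
  then have "transform (minpoly y) \<in> monic_irreducibles" "period y = n"
    by (auto simp: C_set_def monic_irreducibles_deg_def)
  moreover from this(1) have "transform (minpoly y) = minpoly x"
    by (rule monic_irreducible_eq_minpoly) (rule aeval_transform_fibre[OF assms])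
  ultimately show "period y = n \<and> period x = s * n"
    using degree_transform[of y] by simp
next
  assume period: "period y = n \<and> period x = s * n"
  have "minpoly x = transform (minpoly y)"
  proof (rule monic_dvd_same_degree_eq)
    show "minpoly x dvd transform (minpoly y)"
      by (rule minpoly_dvd[OF aeval_transform_fibre[OF assms]])
    show "degree (minpoly x) = degree (transform (minpoly y))"
      unfolding degree_transform using period by simp
  qed (simp_all add: lead_coeff_transform)
  then show "minpoly y \<in> C_set G g h n"
    using period minpoly_monic_irreducible_deg[of x "s * n"]
    by (simp add: C_set_def minpoly_monic_irreducible_deg card_G)
qed


subsection \<open>Ramification\<close>

text \<open>A Frobenius power fixing \<open>y\<close> preserves its fibre, hence fixes the only
  point in it.\<close>

lemma period_ramified_fibre:
  assumes "fibre y = {x}"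
  shows "period x = period y"
proof (rule dvd_antisym)
  have "(frob ^^ period y) x \<in> fibre ((frob ^^ period y) y)"
    unfolding frob_pow_mem_fibre_iff using assms by simp
  then have "(frob ^^ period y) x = x" using assms by simp
  then show "period x dvd period y" by (simp add: frob_pow_fixed_iff)
  show "period y dvd period x" using assms by (intro period_fibre_dvd) simp
qed

text \<open>The left side is linear in \<open>t\<close> and vanishes at \<open>z\<close>.\<close>

lemma fixed_num_diff:
  assumes "fixes_point A z"
  shows "num A t - z * den A t = (t - z) * (to_ac (A$1$1) - to_ac (A$2$1) * z)"
proof -
  have "to_ac (A$1$2) = z * (to_ac (A$2$1) * z + to_ac (A$2$2)) - to_ac (A$1$1) * z"
    using assms by (simp add: fixes_point_def num_def den_def algebra_simps eq_diff_eq)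
  then show ?thesis by (simp add: num_def den_def algebra_simps)
qed

text \<open>Otherwise the first row of \<open>A\<close> would be \<open>z\<close> times the second,
  making \<open>A\<close> singular.\<close>

lemma fixed_not_image_of_infinity:
  assumes "invertible A" and "fixes_point A z"
  shows "to_ac (A$1$1) - to_ac (A$2$1) * z \<noteq> 0"
proof
  assume "to_ac (A$1$1) - to_ac (A$2$1) * z = 0"
  then have eq: "num A t = z * den A t" for t
    using fixed_num_diff[OF assms(2), of t] by simp
  have a: "to_ac (A$1$1) = to_ac (A$2$1) * z" and b: "to_ac (A$1$2) = z * to_ac (A$2$2)"
    using eq[of 0] eq[of 1] by (simp_all add: num_def den_def algebra_simps)
  have "to_ac (A$1$1 * A$2$2 - A$1$2 * A$2$1) = 0"
    by (simp add: a b)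
  then show False using det_nonzero[OF assms(1)] by (simp del: to_ac_diff to_ac_mult)
qed

text \<open>\<open>A\<close> fixes every conjugate of \<open>x\<close>, so it changes each linear
  factor of \<open>minpoly x\<close> only by a nonzero constant, which the normalization in
  \<open>poly_act\<close> removes.\<close>

lemma poly_act_fixed:
  assumes "invertible A" and "fixes_point A x"
  shows "poly_act A (minpoly x) = minpoly x"
proof -
  define p where "p = rational_transform (minpoly x) [:A$1$2, A$1$1:] [:A$2$2, A$2$1:]"
  define c where "c = (\<Prod>i<period x. to_ac (A$1$1) - to_ac (A$2$1) * (frob ^^ i) x)"
  have fixed: "fixes_point A ((frob ^^ i) x)" for i
    using assms(2) by (rule fixes_point_frob_pow)
  have c: "c \<noteq> 0"
    unfolding c_def using fixed_not_image_of_infinity[OF assms(1) fixed] by simp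
  have num_den: "aeval [:A$1$2, A$1$1:] t = num A t" "aeval [:A$2$2, A$2$1:] t = den A t" for t
    by (simp_all add: num_def den_def mult.commute add.commute)
  have "aeval p t = c * aeval (minpoly x) t" for t
    unfolding p_def aeval_rational_transform_split[OF lift_ac_minpoly] num_den
      fixed_num_diff[OF fixed] prod.distrib
    by (simp add: c_def lift_ac_minpoly poly_prod mult.commute)
  then have lift: "lift_ac p = smult c (lift_ac (minpoly x))"
    by (intro poly_eq_if_cofinitely_eq[of "{}"]) simp_all
  \<comment> \<open>Comparing leading coefficients shows that the constant \<open>c\<close> lies in
    the base field.\<close>
  from arg_cong[OF this, of "\<lambda>p. coeff p (period x)"]
  have "to_ac (coeff p (period x)) = c" by simp
  then obtain d where d: "c = to_ac d" by blast
  with lift have "lift_ac p = lift_ac (smult d (minpoly x))" by simp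
  then have "p = smult d (minpoly x)" by (simp only: lift_ac_eq_iff)
  moreover have "d \<noteq> 0" using c d by simp
  ultimately show ?thesis by (simp add: poly_act_def flip: p_def)
qed

lemma exists_nonscalar: "\<exists>D\<in>\<Union>G. D \<notin> scalars2"
proof -
  have "G \<noteq> {\<one>\<^bsub>PGL2\<^esub>}" using card_G s_gt_1 by auto
  then obtain U where U: "U \<in> G" "U \<noteq> scalars2"
    using subgroup.one_closed[OF subgroup_G] by (auto simp: PGL2_one)
  have one: "(scalars2 :: ('a ^ 2 ^ 2) set) \<in> carrier PGL2"
    using G_carrier[OF subgroup.one_closed[OF subgroup_G]] by (simp add: PGL2_one)
  have "rep U \<notin> scalars2"
    using PGL2_class_disjoint[OF G_carrier[OF U(1)] one rep_mem[OF U(1)]] U(2) by blast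
  with rep_mem_Union[OF U(1)] show ?thesis by blast
qed

text \<open>The transform is the power \<open>minpoly x ^ s\<close>, and the orbit of
  \<open>minpoly x\<close> is a singleton; so \<open>minpoly x\<close> and \<open>s\<close> serve as
  \<open>r\<close> and \<open>k\<close>.\<close>

lemma ramified_imp_exceptional:
  assumes fibre: "fibre y = {x}" and fixed: "\<And>A. A \<in> \<Union>G \<Longrightarrow> fixes_point A x"
  shows "minpoly y \<in> exceptional_polys G g h"
proof -
  have period: "period x = period y" by (rule period_ramified_fibre[OF fibre])
  have fixed': "fixes_point A ((frob ^^ i) x)" if "A \<in> \<Union>G" for A i
    using fixed[OF that] by (rule fixes_point_frob_pow)
  \<comment> \<open>Over each conjugate of \<open>y\<close> all \<open>s\<close> factors in
    \<open>fibre_product\<close> coincide.\<close>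
  have factor: "aeval g t - (frob ^^ i) y * aeval h t = (t - (frob ^^ i) x) ^ s" for i t
  proof -
    have "(frob ^^ i) x \<in> fibre ((frob ^^ i) y)"
      using fibre by (simp add: frob_pow_mem_fibre_iff)
    then have hx: "aeval h ((frob ^^ i) x) \<noteq> 0"
      and y: "(frob ^^ i) y * aeval h ((frob ^^ i) x) = aeval g ((frob ^^ i) x)"
      by (auto simp: fibre_h_nonzero) (simp add: fibre_def)
    have act: "act U ((frob ^^ i) x) = (frob ^^ i) x" if "U \<in> G" for U
      by (rule act_eq_if_fixed[OF that fixed'[OF rep_mem_Union[OF that]]])
    have "aeval h ((frob ^^ i) x) * (aeval g t - (frob ^^ i) y * aeval h t) =
        aeval g t * aeval h ((frob ^^ i) x) - aeval g ((frob ^^ i) x) * aeval h t"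
      unfolding y[symmetric] by (simp add: algebra_simps)
    also have "\<dots> = aeval h ((frob ^^ i) x) * (t - (frob ^^ i) x) ^ s"
      unfolding fibre_product[OF hx] using act by (simp add: card_G)
    finally show ?thesis using hx by simp
  qed
  have "aeval (transform (minpoly y)) t = aeval (minpoly x ^ s) t" for t
    by (simp add: aeval_transform factor lift_ac_minpoly poly_prod period prod_power_distrib)
  then have "lift_ac (transform (minpoly y)) = lift_ac (minpoly x ^ s)"
    by (intro poly_eq_if_cofinitely_eq[of "{}"]) simp_all
  then have "transform (minpoly y) = minpoly x ^ s" by (simp only: lift_ac_eq_iff)
  moreover have "poly_orbit G (minpoly x) = {minpoly x}"
  proof -
    have "\<Union>G \<noteq> {}" using exists_nonscalar by blast
    moreover have "poly_act A (minpoly x) = minpoly x" if "A \<in> \<Union>G" for A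
      by (rule poly_act_fixed[OF G_invertible[OF that] fixed[OF that]])
    then have "(\<lambda>A. poly_act A (minpoly x)) ` \<Union>G = (\<lambda>A. minpoly x) ` \<Union>G"
      by (intro image_cong refl)
    moreover have "poly_orbit G (minpoly x) = (\<lambda>A. poly_act A (minpoly x)) ` \<Union>G"
      unfolding poly_orbit_def by (rule Setcompr_eq_image)
    ultimately show ?thesis by (simp only: image_constant_conv if_False)
  qed
  moreover have "minpoly x \<in> monic_irreducibles_avoiding G"
  proof -
    \<comment> \<open>Such a root would be a conjugate of \<open>x\<close>, hence fixed by
      \<open>G\<close>, and also the image of infinity under some \<open>A\<close> in
      \<open>G\<close>.\<close>
    have False if v: "Some v \<in> orbit_infinity G" "poly (minpoly x) v = 0" for v
    proof -
      obtain A where A: "A \<in> \<Union>G" "Some v = moebius_point A None"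
        using v(1) by (auto simp: orbit_infinity_def)
      then have "A$2$1 \<noteq> 0" "v = A$1$1 / A$2$1" by (auto split: if_splits)
      then have "to_ac (A$1$1) - to_ac (A$2$1) * to_ac v = 0" by simp
      moreover have "aeval p (to_ac v) = to_ac (poly p v)" for p by (induction p) simp_all
      then have "aeval (minpoly x) (to_ac v) = 0" using v(2) by simp
      then obtain i where "to_ac v = (frob ^^ i) x" unfolding aeval_minpoly_eq_0_iff by blast
      ultimately show False
        using fixed_not_image_of_infinity[OF G_invertible[OF A(1)] fixed'[OF A(1), of i]] by simp
    qed
    then show ?thesis
      using minpoly_monic_irreducible by (auto simp: monic_irreducibles_avoiding_def)
  qed
  ultimately show ?thesis
    using minpoly_monic_irreducible[of y] s_gt_1 unfolding exceptional_polys_def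
    by (intro CollectI conjI bexI[of _ "minpoly x"] exI[of _ s]) simp_all
qed

text \<open>A proper power has fewer distinct roots than its degree, whereas a fibre with
  \<open>s\<close> points makes all roots of the transform distinct.\<close>

lemma exceptional_imp_ramified:
  assumes "minpoly y \<in> exceptional_polys G g h"
  shows "card (fibre y) \<noteq> s"
proof
  assume card: "card (fibre y) = s"
  obtain p k where p: "transform (minpoly y) = p ^ k" "k > 1"
    using assms by (auto simp: exceptional_polys_def)
  have "p \<noteq> 0" using transform_nonzero[of y] p by auto
  then have deg: "s * period y = k * degree p"
    using degree_transform[of y] p(1) by (simp add: degree_power_eq)
  have "s * period y = card {t. aeval p t = 0}"
    using card_roots_transform[OF card] p by simp
  also have "\<dots> \<le> degree p" using card_poly_roots_bound[of "lift_ac p"] \<open>p \<noteq> 0\<close> by simp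
  finally have "k * degree p \<le> 1 * degree p" using deg by simp
  moreover have "degree p > 0" using deg s_gt_1 period_pos[of y] by (cases "degree p") auto
  ultimately show False using p(2) by simp
qed

text \<open>Finiteness makes the \<open>Max\<close> in \<open>d_inv\<close> a genuine upper bound.
  Exceptional polynomials arise from values of \<open>Q\<close> at the finitely many points fixed by
  nonscalar matrices.\<close>

lemma finite_exceptional: "finite (exceptional_polys G g h)"
proof (rule finite_subset)
  show "exceptional_polys G g h \<subseteq>
      (\<lambda>x. minpoly (aeval g x / aeval h x)) ` {x. \<exists>D\<in>\<Union>G - scalars2. fixes_point D x}"
  proof
    fix f assume f: "f \<in> exceptional_polys G g h"
    then have "f \<in> monic_irreducibles" by (simp add: exceptional_polys_def)
    then obtain y where y: "f = minpoly y" by (rule monic_irreducible_obtains_root)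
    with f have "card (fibre y) \<noteq> s" using exceptional_imp_ramified by blast
    then obtain x where x: "fibre y = {x}" and fixed: "\<And>A. A \<in> \<Union>G \<Longrightarrow> fixes_point A x"
      using fibre_cases[of y] by metis
    have "y = aeval g x / aeval h x" using x mem_fibre_iff[of x y] by blast
    moreover have "\<exists>D\<in>\<Union>G - scalars2. fixes_point D x" using exists_nonscalar fixed by blast
    ultimately show "f \<in> (\<lambda>x. minpoly (aeval g x / aeval h x)) `
        {x. \<exists>D\<in>\<Union>G - scalars2. fixes_point D x}"
      using y by blast
  qed
qed (intro finite_imageI finite_fixed)

lemma exceptional_degree_le: "f \<in> exceptional_polys G g h \<Longrightarrow> degree f \<le> d_inv G g h"
  using finite_exceptional by (auto simp: d_inv_def)

lemma card_fibre_if_period_gt: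
  assumes "period y > d_inv G g h"
  shows "card (fibre y) = s"
proof (cases rule: fibre_cases[of y])
  case (2 x)
  then have "minpoly y \<in> exceptional_polys G g h" by (rule ramified_imp_exceptional)
  then have "period y \<le> d_inv G g h" using exceptional_degree_le by fastforce
  with assms show ?thesis by simp
qed

text \<open>
  A pole of the quotient map in the affine line is rational, and it is moved to infinity by a
  matrix in \<open>G\<close> that has a fixed point, whence \<open>d_inv G g h \<ge> 1\<close>.
\<close>

lemma pole_period_le:
  assumes "aeval h x = 0"
  shows "period x \<le> d_inv G g h"
proof -
  obtain A where A: "A \<in> \<Union>G" "den A x = 0" using pole_imp_den_zero[OF assms] by blast
  note inv = G_invertible[OF A(1)]
  have c: "A$2$1 \<noteq> 0"
  proof
    assume "A$2$1 = 0"
    then show False using A(2) det_nonzero[OF inv] by (simp add: den_def)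
  qed
  have "to_ac (A$2$1) * x = - to_ac (A$2$2)"
    using A(2) by (simp add: den_def eq_neg_iff_add_eq_0)
  then have "x = to_ac (- A$2$2 / A$2$1)" using c by (simp add: field_simps)
  then have "frob x = x" by (simp only: frob_to_ac)
  then have "period x dvd 1" using frob_pow_fixed_iff[of 1 x] by simp
  then have one: "period x = 1" by simp
  obtain z where z: "fixes_point A z" using exists_fixed_point[of A, OF c] by blast
  have "A \<notin> scalars2" using c by (auto simp: scalars2_def mat_def)
  then have fixed: "fixes_point B z" if "B \<in> \<Union>G" for B
    using fixes_point_all[OF A(1) _ z that] by blast
  define y where "y = aeval g z / aeval h z"
  have "minpoly y \<in> exceptional_polys G g h"
    unfolding y_def by (rule ramified_imp_exceptional[OF fixed_imp_fibre[OF fixed] fixed])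
  then have "period y \<le> d_inv G g h" using exceptional_degree_le by fastforce
  moreover have "period y \<ge> 1" by (simp add: Suc_leI)
  ultimately show ?thesis using one by simp
qed


subsection \<open>Counting\<close>

lemma card_Union_fibres:
  assumes "finite Y" and "\<And>y. y \<in> Y \<Longrightarrow> card (fibre y) = s"
  shows "card (\<Union>y\<in>Y. fibre y) = s * card Y"
proof -
  have "card (\<Union>y\<in>Y. fibre y) = (\<Sum>y\<in>Y. card (fibre y))"
    using assms(1) fibre_disjoint by (intro card_UN_disjoint) auto
  then show ?thesis using assms(2) by (simp add: mult.commute)
qed

lemma C_set_subset: "C_set G g h n \<subseteq> monic_irreducibles_deg n"
  and D_set_subset: "D_set G g h n \<subseteq> monic_irreducibles_deg n"
  by (auto simp: C_set_def D_set_def)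

lemma finite_C_set: "finite (C_set G g h n)"
  and finite_D_set: "finite (D_set G g h n)"
  using finite_subset[OF C_set_subset finite_monic_irreducibles_deg]
    finite_subset[OF D_set_subset finite_monic_irreducibles_deg] .

text \<open>
  Split the \<open>x\<close> of degree \<open>n\<close> by the degree of \<open>y = g x / h x\<close>: if it is \<open>n\<close> then \<open>y\<close> is a root of an
  element of \<open>D_set G g h n\<close>, otherwise \<open>y\<close> is a root of an element of \<open>C_set G g h (n div s)\<close>.
\<close>

lemma card_D_set_C_set:
  assumes n: "n > d_inv G g h"
  shows "card (monic_irreducibles_deg n :: 'a poly set) =
    s * card (D_set G g h n) + (if s dvd n then card (C_set G g h (n div s)) else 0)"
proof -
  define YD where "YD = minpoly -` D_set G g h n"
  define YC where "YC = (if s dvd n then minpoly -` C_set G g h (n div s) else {})"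
  have YD: "y \<in> YD \<longleftrightarrow> period y = n \<and> period x \<noteq> s * n" if "x \<in> fibre y" for x y
    using minpoly_mem_C_set_iff[OF that, of n]
    by (auto simp: YD_def D_set_def minpoly_monic_irreducible_deg)
  have YC: "y \<in> YC \<longleftrightarrow> period x = n \<and> n = s * period y" if "x \<in> fibre y" for x y
  proof (cases "s dvd n")
    case True
    then obtain k where "n = s * k" ..
    then show ?thesis
      using minpoly_mem_C_set_iff[OF that, of k] s_gt_1 by (auto simp: YC_def)
  qed (auto simp: YC_def)
  have YD_fibre: "card (fibre y) = s" if "y \<in> YD" for y
  proof -
    obtain x where "x \<in> fibre y" using fibre_nonempty by blast
    with that have "period y = n" using YD by blast
    with n show ?thesis by (intro card_fibre_if_period_gt) simp
  qed
  \<comment> \<open>Here \<open>y\<close> has degree \<open>n div s\<close>, which need not exceed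
    \<open>d_inv G g h\<close>; ramification is excluded by comparing periods instead.\<close>
  have YC_fibre: "card (fibre y) = s" if "y \<in> YC" for y
  proof (cases rule: fibre_cases[of y])
    case (2 x)
    then have "period x = s * period y" using YC[of x y] that by simp
    moreover have "period x = period y" by (rule period_ramified_fibre[OF 2(1)])
    ultimately show ?thesis using s_gt_1 by simp
  qed
  have "{x. period x = n} = (\<Union>y\<in>YD. fibre y) \<union> (\<Union>y\<in>YC. fibre y)"
  proof (intro Set.set_eqI iffI)
    fix x :: "'a alg_closure"
    assume "x \<in> {x. period x = n}"
    then have x: "period x = n" by simp
    define y where "y = aeval g x / aeval h x"
    have fib: "x \<in> fibre y"
      using pole_period_le[of x] x n by (auto simp: mem_fibre_iff y_def)
    \<comment> \<open>Positivity separates \<open>n\<close> from \<open>s * n\<close>, as membership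
      in \<open>YD\<close> demands.\<close>
    have pos: "n > 0" using x period_pos[of x] by simp
    show "x \<in> (\<Union>y\<in>YD. fibre y) \<union> (\<Union>y\<in>YC. fibre y)"
    proof (cases "period y = n")
      case True
      then have "y \<in> YD" using YD[OF fib] x pos s_gt_1 by simp
      with fib show ?thesis by blast
    next
      case False
      have "card (fibre y) = s"
      proof (cases rule: fibre_cases[of y])
        case (2 z)
        then have "period y = n" using period_ramified_fibre[OF 2(1)] fib x by simp
        with False show ?thesis by simp
      qed
      then have "period x = s * period y" using period_unramified_fibre[OF _ fib] False x by auto
      then have "y \<in> YC" using YC[OF fib] x by simp
      with fib show ?thesis by blast
    qed
  next
    fix x :: "'a alg_closure"
    assume "x \<in> (\<Union>y\<in>YD. fibre y) \<union> (\<Union>y\<in>YC. fibre y)"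
    then obtain y where fib: "x \<in> fibre y" and "y \<in> YD \<or> y \<in> YC" by blast
    then show "x \<in> {x. period x = n}"
      using YD[OF fib] YC[OF fib] YD_fibre[of y] period_unramified_fibre[OF _ fib] by auto
  qed
  moreover have "(\<Union>y\<in>YD. fibre y) \<inter> (\<Union>y\<in>YC. fibre y) = {}"
  proof -
    have False if "x \<in> fibre y" "y \<in> YD" "x \<in> fibre z" "z \<in> YC" for x y z
    proof -
      \<comment> \<open>A common point would force \<open>n = s * n\<close>.\<close>
      have "y = z" using that(1,3) by (simp add: mem_fibre_iff)
      then have "n = s * n" "period x = n"
        using YD[OF that(1)] YC[OF that(3)] that(2,4) by auto
      then show False using s_gt_1 period_pos[of x] by simp
    qed
    then show ?thesis by blast
  qed
  moreover have finYD: "finite YD" and cardYD: "card YD = n * card (D_set G g h n)"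
    using card_minpoly_vimage[OF D_set_subset finite_D_set] by (simp_all add: YD_def)
  moreover have finYC: "finite YC"
    using card_minpoly_vimage[OF C_set_subset finite_C_set] by (simp add: YC_def)
  ultimately have "card {x :: 'a alg_closure. period x = n} = s * card YD + s * card YC"
    using card_Union_fibres[OF finYD YD_fibre] card_Union_fibres[OF finYC YC_fibre]
    by (simp add: card_Un_disjoint)
  moreover have "card {x :: 'a alg_closure. period x = n} =
      n * card (monic_irreducibles_deg n :: 'a poly set)"
  proof -
    have "{x :: 'a alg_closure. period x = n} = minpoly -` monic_irreducibles_deg n"
      by (auto simp: minpoly_monic_irreducible_deg)
    then show ?thesis using card_minpoly_vimage(2)[OF order_refl finite_monic_irreducibles_deg] by simp
  qed
  \<comment> \<open>Each polynomial has \<open>n div s\<close> roots and each root has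
    \<open>s\<close> points above it, which restores the factor \<open>n\<close>.\<close>
  moreover have "s * card YC = n * (if s dvd n then card (C_set G g h (n div s)) else 0)"
    using card_minpoly_vimage(2)[OF C_set_subset finite_C_set, of "n div s"]
    by (simp add: YC_def flip: mult.assoc)
  ultimately have "n * card (monic_irreducibles_deg n :: 'a poly set) =
      n * (s * card (D_set G g h n) + (if s dvd n then card (C_set G g h (n div s)) else 0))"
    using cardYD by (simp add: distrib_left mult_ac)
  then show ?thesis using n by simp
qed

end

theorem theorem4:
  fixes G :: "('a::{field, finite} ^ 2 ^ 2) set set"
    and g h :: "'a poly" and s n :: nat
  assumes "subgroup G PGL2"
    and "cyclic_group (PGL2\<lparr>carrier := G\<rparr>)"
    and "card G = s" and "prime s"
    and "quotient_map G g h"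
    and "n > d_inv G g h"
  shows "int (card (C_set G g h n)) - (int s - 1) * int (card (D_set G g h n)) =
    (if s dvd n then int (card (C_set G g h (n div s))) else 0)"
proof -
  interpret prime_quotient_map G g h s
    by (rule prime_quotient_map.intro) fact+
  have "card (D_set G g h n) + card (C_set G g h n) = card (monic_irreducibles_deg n :: 'a poly set)"
    using card_Diff_subset[OF finite_C_set C_set_subset, of n]
      card_mono[OF finite_monic_irreducibles_deg C_set_subset, of n]
    by (simp add: D_set_def)
  then have "int (card (D_set G g h n)) + int (card (C_set G g h n)) =
      int (s * card (D_set G g h n) + (if s dvd n then card (C_set G g h (n div s)) else 0))"
    unfolding card_D_set_C_set[OF assms(6)] by (simp flip: of_nat_add)
  then show ?thesis by (simp add: algebra_simps)
qed

end
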